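(* Let $n\ge1$ be an integer. (1) Let $\alpha,\beta>0$. If $\mu_+$ and $\mu_-$ are the maxima of $|g_n^{(\alpha,\beta)}|$ on the nodal intervals adjacent to $x=1$ and $x=-1$, respectively, then $$\max_{-1\le x\le1}|g_n^{(\alpha,\beta)}(x)|=\max\{\mu_+,\mu_-\}<\max\{R_*(\alpha)^{-1/2},R_*(\beta)^{-1/2}\}<1.$$ (2) For all $\alpha,\beta\ge0$ (with $R_*(0)=1$), $$\max_{-1\le x\le1}|g_n^{(\alpha,\beta)}(x)|\le\max\{R_*(\alpha)^{-1/2},R_*(\beta)^{-1/2}\}.$$ (3) Consequently, for all $\alpha,\beta\ge0$, $$\max_{-1\le x\le1}|g_n^{(\alpha,\beta)}(x)|\le\min\Big\{T_{n,\alpha,\beta},\ \max\{R_*(\alpha)^{-1/2},R_*(\beta)^{-1/2}\}\Big\}.$$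
   Context: $P_n^{(\alpha,\beta)}$ is the Jacobi polynomial of degree $n$ in the standard normalization, $P_n^{(\alpha,\beta)}(1)=\frac{\Gamma(n+\alpha+1)}{n!\,\Gamma(\alpha+1)}$. The normalized weighted Jacobi function is $$g_n^{(\alpha,\beta)}(x)=\left[\frac{\Gamma(n+1)\Gamma(n+\alpha+\beta+1)}{\Gamma(n+\alpha+1)\Gamma(n+\beta+1)}\right]^{1/2}\left(\frac{1-x}{2}\right)^{\alpha/2}\left(\frac{1+x}{2}\right)^{\beta/2}P_n^{(\alpha,\beta)}(x),\quad x\in[-1,1].$$ At $x=\pm1$, powers $0^0$ are understood by continuous extension in $x$ with the parameters fixed (so $0^0=1$). The nodal interval adjacent to $x=1$ is the interval between the largest zero of $P_n^{(\alpha,\beta)}$ in $(-1,1)$ and $1$; the nodal interval adjacent to $x=-1$ is the interval between $-1$ and the smallest zero. For $a>0$, $$R_*(a)=\frac{a+2}{2(a+1)}\left(\frac{a+2}{a}\right)^a,\qquad R_*(0):=1,$$ and $$T_{n,\alpha,\beta}=\left[\frac{(n+1)(n+\alpha+\beta+1)}{(n+\alpha+1)(n+\beta+1)}\right]^{1/4}.$$ *)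

theory Defs
  imports "HOL-Analysis.Analysis" "HOL-Computational_Algebra.Polynomial"
begin

text \<open>
  The Jacobi polynomial, for \<open>\<alpha> > -1\<close>, via the hypergeometric representation
  \<open>P_n(x) = (\<alpha>+1)_n / n! * 2F1(-n, n+\<alpha>+\<beta>+1; \<alpha>+1; (1-x)/2)\<close>, where \<open>(a)_k\<close> is the rising
  factorial.
\<close>
definition jacobi_poly :: "nat \<Rightarrow> real \<Rightarrow> real \<Rightarrow> real poly" where
  "jacobi_poly n \<alpha> \<beta> =
     smult (pochhammer (\<alpha> + 1) n / fact n)
       (\<Sum>k\<le>n. smult (pochhammer (- real n) k * pochhammer (real n + \<alpha> + \<beta> + 1) k
                        / (pochhammer (\<alpha> + 1) k * fact k))
                ([:1/2, -1/2:] ^ k))"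

lemma jacobi_poly_at_1:
  assumes "\<alpha> > -1"
  shows "poly (jacobi_poly n \<alpha> \<beta>) 1 = Gamma (real n + \<alpha> + 1) / (fact n * Gamma (\<alpha> + 1))"
proof -
  have "\<alpha> + 1 \<notin> \<int>\<^sub>\<le>\<^sub>0"
    using assms by (auto elim!: nonpos_Ints_cases)
  then have "pochhammer (\<alpha> + 1) n = Gamma (\<alpha> + 1 + real n) / Gamma (\<alpha> + 1)"
    by (rule pochhammer_Gamma)
  then show ?thesis
    by (simp add: jacobi_poly_def poly_sum power_0_left if_distrib sum.delta
        add_ac cong: if_cong)
qed

text \<open>Real powers of a nonnegative base with \<open>0^0 = 1\<close>; the library has \<open>0 powr 0 = 0\<close>.\<close>
definition rpow :: "real \<Rightarrow> real \<Rightarrow> real" where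
  "rpow x a = (if a = 0 then 1 else x powr a)"

definition jacobi_g :: "nat \<Rightarrow> real \<Rightarrow> real \<Rightarrow> real \<Rightarrow> real" where
  "jacobi_g n \<alpha> \<beta> x =
     sqrt (Gamma (real n + 1) * Gamma (real n + \<alpha> + \<beta> + 1)
           / (Gamma (real n + \<alpha> + 1) * Gamma (real n + \<beta> + 1)))
     * rpow ((1 - x) / 2) (\<alpha> / 2) * rpow ((1 + x) / 2) (\<beta> / 2) * poly (jacobi_poly n \<alpha> \<beta>) x"

definition jacobi_zeros :: "nat \<Rightarrow> real \<Rightarrow> real \<Rightarrow> real set" where
  "jacobi_zeros n \<alpha> \<beta> = {x \<in> {-1<..<1}. poly (jacobi_poly n \<alpha> \<beta>) x = 0}"

definition nodal_right :: "nat \<Rightarrow> real \<Rightarrow> real \<Rightarrow> real set" where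
  "nodal_right n \<alpha> \<beta> = {Max (jacobi_zeros n \<alpha> \<beta>)..1}"

definition nodal_left :: "nat \<Rightarrow> real \<Rightarrow> real \<Rightarrow> real set" where
  "nodal_left n \<alpha> \<beta> = {-1..Min (jacobi_zeros n \<alpha> \<beta>)}"

definition is_max_on :: "(real \<Rightarrow> real) \<Rightarrow> real set \<Rightarrow> real \<Rightarrow> bool" where
  "is_max_on f S m \<longleftrightarrow> m \<in> f ` S \<and> (\<forall>x\<in>S. f x \<le> m)"

definition R_star :: "real \<Rightarrow> real" where
  "R_star a = (if a = 0 then 1 else (a + 2) / (2 * (a + 1)) * ((a + 2) / a) powr a)"

definition T_bound :: "nat \<Rightarrow> real \<Rightarrow> real \<Rightarrow> real" where
  "T_bound n \<alpha> \<beta> =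
     ((real n + 1) * (real n + \<alpha> + \<beta> + 1) / ((real n + \<alpha> + 1) * (real n + \<beta> + 1))) powr (1/4)"

end

theory Submission imports Defs begin

text \<open>
  Put \<open>u = (1 - x)/2\<close> and write \<open>y = u^(\<alpha>/2) (1 - u)^(\<beta>/2) p(u)\<close>, so that \<open>g\<^sup>2 = c y\<^sup>2\<close> with the
  normalising constant \<open>c\<close>. Integration by parts in Rodrigues' formula gives \<open>c \<integral> y\<^sup>2/u du = 1/\<alpha>\<close>.
  Since all zeros of \<open>p\<close> lie in \<open>(0,1)\<close>, the function \<open>\<phi> = (1 - u)^(\<beta>/2) p(u)\<close> is convex up to its
  first zero and hence lies above its tangent at the first peak \<open>s\<close> of \<open>y\<close>; that tangent vanishes
  at \<open>s (\<alpha> + 2)/\<alpha>\<close>. Integrating \<open>u^(\<alpha>-1)\<close> times the squared tangent gives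
  \<open>c y(s)\<^sup>2 R_star \<alpha> / \<alpha> < 1/\<alpha>\<close>. A Sonin-type argument shows that the global maximum is attained
  on one of the two outer nodal intervals. If a parameter vanishes, \<open>|g| \<le> 1\<close> follows by a limit.

  For \<open>T_bound\<close>, an Agmon estimate with the exactly known integrals of \<open>y\<^sup>2/u\<close>, \<open>y\<^sup>2/(1 - u)\<close> and \<open>y\<^sup>2\<close>
  gives \<open>g^4 \<le> (2n + 1)(\<alpha> + \<beta>)/(4 \<alpha> \<beta>)\<close>, which is at most the fourth power of \<open>T_bound\<close> when
  \<open>\<alpha> \<beta> \<ge> (n + 1)(n + 1 + \<alpha> + \<beta>)\<close>; otherwise that fourth power exceeds \<open>1/2\<close> and the \<open>R_star\<close>
  bound is the stronger one.
\<close>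

subsection \<open>Jacobi polynomials in the variable \<open>u = (1 - x)/2\<close>\<close>

definition jacobi_coef :: "nat \<Rightarrow> real \<Rightarrow> real \<Rightarrow> nat \<Rightarrow> real" where
  "jacobi_coef n \<alpha> \<beta> k = pochhammer (\<alpha> + 1) n / fact n *
     (pochhammer (- real n) k * pochhammer (real n + \<alpha> + \<beta> + 1) k / (pochhammer (\<alpha> + 1) k * fact k))"

definition jacobi_u :: "nat \<Rightarrow> real \<Rightarrow> real \<Rightarrow> real poly" where
  "jacobi_u n \<alpha> \<beta> = (\<Sum>k\<le>n. monom (jacobi_coef n \<alpha> \<beta> k) k)"

lemma poly_jacobi_poly: "poly (jacobi_poly n \<alpha> \<beta>) x = poly (jacobi_u n \<alpha> \<beta>) ((1 - x) / 2)"
  by (simp add: jacobi_poly_def jacobi_u_def jacobi_coef_def poly_sum poly_monom sum_distrib_left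
      diff_divide_distrib mult.assoc)

text \<open>The factor \<open>pochhammer (- real n) k\<close> vanishes for k > n, so one formula
  covers all k and coefficient comparisons need no case split at the degree.\<close>

lemma coeff_jacobi_u: "coeff (jacobi_u n \<alpha> \<beta>) k = jacobi_coef n \<alpha> \<beta> k"
proof (cases "k \<le> n")
  case True
  then show ?thesis by (simp add: jacobi_u_def coeff_sum coeff_monom)
next
  case False
  then have "pochhammer (- real n) k = 0" by (simp add: pochhammer_of_nat_eq_0_iff)
  with False show ?thesis by (simp add: jacobi_u_def jacobi_coef_def coeff_sum coeff_monom)
qed

lemma degree_jacobi_u: "degree (jacobi_u n \<alpha> \<beta>) \<le> n"
  unfolding jacobi_u_def by (intro degree_sum_le) (auto intro: order_trans[OF degree_monom_le])

lemma jacobi_u_0 [simp]: "jacobi_u 0 \<alpha> \<beta> = 1"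
  by (simp add: jacobi_u_def jacobi_coef_def)

lemma poly_jacobi_u_at_0: "poly (jacobi_u n \<alpha> \<beta>) 0 = pochhammer (\<alpha> + 1) n / fact n"
  by (simp add: poly_0_coeff_0 coeff_jacobi_u jacobi_coef_def)

lemma jacobi_coef_lead:
  assumes "\<alpha> > -1"
  shows "jacobi_coef n \<alpha> \<beta> n = (-1) ^ n * pochhammer (real n + \<alpha> + \<beta> + 1) n / fact n"
proof -
  have "pochhammer (\<alpha> + 1) n > 0" using assms by (intro pochhammer_pos) auto
  moreover have "pochhammer (- real n) n = (-1) ^ n * fact n"
    by (simp add: pochhammer_same)
  ultimately show ?thesis by (simp add: jacobi_coef_def)
qed

text \<open>Coefficient form of the classical derivative rule: differentiation lowers n by one and
  raises both parameters by one. Splitting off the first factor of each rising factorial leaves the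
  same shifted factorials on both sides.\<close>

lemma jacobi_coef_Suc_Suc:
  assumes "\<alpha> > -1"
  shows "real (Suc k) * jacobi_coef (Suc n) \<alpha> \<beta> (Suc k)
    = - (real n + \<alpha> + \<beta> + 2) * jacobi_coef n (\<alpha> + 1) (\<beta> + 1) k"
proof -
  define A where "A = pochhammer (\<alpha> + 2) n"
  define B where "B = pochhammer (\<alpha> + 2) k"
  define C where "C = pochhammer (- real n) k"
  define D where "D = pochhammer (real n + \<alpha> + \<beta> + 3) k"
  have "B > 0" unfolding B_def using assms by (intro pochhammer_pos) auto
  have "- real (Suc n) + 1 = - real n" "real (Suc n) + \<alpha> + \<beta> + 1 + 1 = real n + \<alpha> + \<beta> + 3" "\<alpha> + 1 + 1 = \<alpha> + 2"
    "real n + (\<alpha> + 1) + (\<beta> + 1) + 1 = real n + \<alpha> + \<beta> + 3"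
    by simp_all
  then have "jacobi_coef (Suc n) \<alpha> \<beta> (Suc k) = (\<alpha> + 1) * A / (real (Suc n) * fact n) *
      ((- real (Suc n) * C) * ((real (Suc n) + \<alpha> + \<beta> + 1) * D) / (((\<alpha> + 1) * B) * (real (Suc k) * fact k)))"
    "jacobi_coef n (\<alpha> + 1) (\<beta> + 1) k = A / fact n * (C * D / (B * fact k))"
    unfolding jacobi_coef_def pochhammer_rec fact_Suc A_def B_def C_def D_def by (simp_all only: of_nat_fact of_nat_mult)
  then show ?thesis using \<open>B > 0\<close> assms
    by (simp del: of_nat_Suc, simp add: divide_simps del: of_nat_Suc, simp add: algebra_simps)
qed

text \<open>The term ratio of the hypergeometric series, cross-multiplied so that it stays valid
  beyond the degree, where the coefficients vanish.\<close>

lemma jacobi_coef_ratio: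
  assumes "\<alpha> > -1"
  shows "(\<alpha> + 1 + real k) * real (Suc k) * jacobi_coef n \<alpha> \<beta> (Suc k)
    = (real k - real n) * (real n + \<alpha> + \<beta> + 1 + real k) * jacobi_coef n \<alpha> \<beta> k"
proof -
  have "pochhammer (\<alpha> + 1) k > 0" using assms by (intro pochhammer_pos) auto
  moreover have "\<alpha> + 1 + real k > 0" using assms by simp
  ultimately show ?thesis
    unfolding jacobi_coef_def pochhammer_Suc fact_Suc
    by (simp add: divide_simps del: of_nat_Suc)
qed

lemma pderiv_jacobi_u:
  assumes "\<alpha> > -1"
  shows "pderiv (jacobi_u (Suc n) \<alpha> \<beta>) = smult (- (real n + \<alpha> + \<beta> + 2)) (jacobi_u n (\<alpha> + 1) (\<beta> + 1))"
  using jacobi_coef_Suc_Suc[OF assms]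
  by (intro poly_eqI) (simp add: coeff_pderiv coeff_jacobi_u)

section \<open>Weighted polynomials and Rodrigues' formula\<close>

text \<open>\<open>(weight_poly a b q)' = weight_poly (a - 1) (b - 1) (weight_diff a b q)\<close> on \<open>(0,1)\<close>.\<close>
definition weight_poly :: "real \<Rightarrow> real \<Rightarrow> real poly \<Rightarrow> real \<Rightarrow> real" where
  "weight_poly a b q u = u powr a * (1 - u) powr b * poly q u"

definition weight_diff :: "real \<Rightarrow> real \<Rightarrow> real poly \<Rightarrow> real poly" where
  "weight_diff a b q = [:a, - (a + b):] * q + [:0, 1, -1:] * pderiv q"

lemma poly_weight_diff:
  "poly (weight_diff a b q) u = (a - (a + b) * u) * poly q u + u * (1 - u) * poly (pderiv q) u"
  by (simp add: weight_diff_def algebra_simps)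

lemma coeff_weight_diff_0: "coeff (weight_diff a b q) 0 = a * coeff q 0"
  by (simp add: weight_diff_def)

lemma coeff_weight_diff_Suc:
  "coeff (weight_diff a b q) (Suc k) = (a + real k + 1) * coeff q (Suc k) - (a + b + real k) * coeff q k"
  by (cases k) (simp_all add: weight_diff_def coeff_pderiv algebra_simps)

lemma weight_poly_deriv:
  assumes "0 < u" "u < 1"
  shows "(weight_poly a b q has_real_derivative weight_poly (a - 1) (b - 1) (weight_diff a b q) u) (at u)"
proof -
  have "((\<lambda>u. u powr a * (1 - u) powr b * poly q u) has_real_derivative
      weight_poly (a - 1) (b - 1) (weight_diff a b q) u) (at u)"
    unfolding weight_poly_def weight_diff_def
    using assms
    by (auto intro!: derivative_eq_intros simp: powr_diff field_simps)
  then show ?thesis by (simp add: weight_poly_def[abs_def])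
qed

lemma weight_poly_continuous:
  assumes "a > 0" "b > 0"
  shows "continuous_on {0..1} (weight_poly a b q)"
  unfolding weight_poly_def[abs_def] using assms
  by (intro continuous_intros continuous_on_powr') auto

text \<open>Since \<open>0 powr a = 0\<close> for every a, even zero or negative, the endpoint
  values vanish by convention. Identities between integrands therefore need checking on the open
  interval only.\<close>

lemma weight_poly_0 [simp]: "weight_poly a b q 0 = 0"
  and weight_poly_1 [simp]: "weight_poly a b q 1 = 0"
  by (simp_all add: weight_poly_def)

text \<open>One step of Rodrigues' formula.\<close>
lemma jacobi_u_Suc:
  assumes "\<alpha> > -1"
  shows "smult (real (Suc n)) (jacobi_u (Suc n) \<alpha> \<beta>)
    = weight_diff (\<alpha> + 1) (\<beta> + 1) (jacobi_u n (\<alpha> + 1) (\<beta> + 1))" (is "?L = ?R")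
proof (rule poly_eqI)
  fix k
  define b where "b = jacobi_coef n (\<alpha> + 1) (\<beta> + 1)"
  show "coeff ?L k = coeff ?R k"
  proof (cases k)
    case 0
    have "\<alpha> + 1 + 1 = \<alpha> + 2" by simp
    then have "(\<alpha> + 1) * b 0 = real (Suc n) * jacobi_coef (Suc n) \<alpha> \<beta> 0"
      unfolding b_def jacobi_coef_def pochhammer_rec fact_Suc by (simp del: of_nat_Suc)
    then show ?thesis
      by (simp only: 0 coeff_smult coeff_jacobi_u coeff_weight_diff_0 b_def)
  next
    case (Suc k)
    have "\<alpha> + 1 > -1" using assms by simp
    from jacobi_coef_ratio[OF this, of k n "\<beta> + 1"]
    have r: "(\<alpha> + 2 + real k) * real (Suc k) * b (Suc k)
      = (real k - real n) * (real n + \<alpha> + \<beta> + 3 + real k) * b k"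
      unfolding b_def[symmetric] by (simp add: add_ac)
    have s: "real (Suc k) * jacobi_coef (Suc n) \<alpha> \<beta> (Suc k) = - (real n + \<alpha> + \<beta> + 2) * b k"
      unfolding b_def by (rule jacobi_coef_Suc_Suc[OF assms])
    \<comment> \<open>Multiplying by k + 1 makes both recurrences applicable: each side becomes a
      multiple of \<open>b k\<close>. The factor is cancelled afterwards.\<close>
    have "real (Suc k) * ((\<alpha> + 2 + real k) * b (Suc k) - (\<alpha> + \<beta> + 2 + real k) * b k)
      = (\<alpha> + 2 + real k) * real (Suc k) * b (Suc k) - real (Suc k) * (\<alpha> + \<beta> + 2 + real k) * b k"
      by (simp only: right_diff_distrib mult_ac)
    also have "\<dots> = real (Suc n) * (real (Suc k) * jacobi_coef (Suc n) \<alpha> \<beta> (Suc k))"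
      unfolding r s by (simp add: algebra_simps)
    finally have "(\<alpha> + 2 + real k) * b (Suc k) - (\<alpha> + \<beta> + 2 + real k) * b k
      = real (Suc n) * jacobi_coef (Suc n) \<alpha> \<beta> (Suc k)"
      by (simp only: mult.left_commute[of _ "real (Suc k)"] mult_cancel_left) simp
    moreover have "\<alpha> + 1 + real k + 1 = \<alpha> + 2 + real k" "\<alpha> + 1 + (\<beta> + 1) + real k = \<alpha> + \<beta> + 2 + real k"
      by simp_all
    ultimately show ?thesis
      by (simp only: Suc coeff_smult coeff_jacobi_u coeff_weight_diff_Suc b_def)
  qed
qed

text \<open>Composition of two shifts: the derivative of p is a multiple of the polynomial Q of
  degree n - 1 with raised parameters, and one Rodrigues step leads from Q back to p.\<close>

lemma jacobi_u_ode:
  assumes "\<alpha> > -1"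
  shows "[:0, 1, -1:] * pderiv (pderiv (jacobi_u n \<alpha> \<beta>))
    = - ([:\<alpha> + 1, - (\<alpha> + \<beta> + 2):] * pderiv (jacobi_u n \<alpha> \<beta>))
      - smult (real n * (real n + \<alpha> + \<beta> + 1)) (jacobi_u n \<alpha> \<beta>)"
proof (cases n)
  case 0
  then show ?thesis by simp
next
  case (Suc m)
  let ?Q = "jacobi_u m (\<alpha> + 1) (\<beta> + 1)"
  let ?c = "real m + \<alpha> + \<beta> + 2"
  have "smult (?c * real (Suc m)) (jacobi_u (Suc m) \<alpha> \<beta>) = smult ?c (weight_diff (\<alpha> + 1) (\<beta> + 1) ?Q)"
    using arg_cong[OF jacobi_u_Suc[OF assms, of m \<beta>], of "smult ?c"] by (simp only: smult_smult)
  also have "\<dots> = smult ?c ([:\<alpha> + 1, - (\<alpha> + \<beta> + 2):] * ?Q + [:0, 1, -1:] * pderiv ?Q)"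
    by (simp add: weight_diff_def add_ac)
  finally have *: "smult (real (Suc m) * (real (Suc m) + \<alpha> + \<beta> + 1)) (jacobi_u (Suc m) \<alpha> \<beta>)
    = smult ?c ([:\<alpha> + 1, - (\<alpha> + \<beta> + 2):] * ?Q + [:0, 1, -1:] * pderiv ?Q)"
    by (simp add: algebra_simps)
  show ?thesis
    unfolding Suc * pderiv_jacobi_u[OF assms] pderiv_smult
    by (simp only: smult_add_right mult_smult_right smult_minus_left) simp
qed

text \<open>Induction along Rodrigues' formula: under u -> 1 - u with the parameters swapped,
  \<open>weight_diff\<close> changes sign, which contributes one factor -1 per degree.\<close>

lemma jacobi_u_reflect:
  assumes "\<alpha> > -1" "\<beta> > -1"
  shows "poly (jacobi_u n \<alpha> \<beta>) (1 - u) = (-1) ^ n * poly (jacobi_u n \<beta> \<alpha>) u"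
  using assms
proof (induction n arbitrary: \<alpha> \<beta> u)
  case 0
  then show ?case by simp
next
  case (Suc n)
  let ?P = "jacobi_u n (\<alpha> + 1) (\<beta> + 1)" and ?Q = "jacobi_u n (\<beta> + 1) (\<alpha> + 1)"
  have IH: "poly ?P (1 - u) = (-1) ^ n * poly ?Q u" for u using Suc by simp
  \<comment> \<open>The induction hypothesis is differentiated: both of its sides are derivatives of
    the same function, so uniqueness equates them.\<close>
  have "((\<lambda>u. poly ?P (1 - u)) has_real_derivative - poly (pderiv ?P) (1 - u)) (at u)"
    by (auto intro!: derivative_eq_intros)
  moreover have "((\<lambda>u. poly ?P (1 - u)) has_real_derivative (-1) ^ n * poly (pderiv ?Q) u) (at u)"
    unfolding IH by (auto intro!: derivative_eq_intros)
  ultimately have d: "poly (pderiv ?P) (1 - u) = - ((-1) ^ n * poly (pderiv ?Q) u)"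
    using DERIV_unique by fastforce
  have "real (Suc n) * poly (jacobi_u (Suc n) \<alpha> \<beta>) (1 - u) = poly (weight_diff (\<alpha> + 1) (\<beta> + 1) ?P) (1 - u)"
    using arg_cong[OF jacobi_u_Suc[of \<alpha> n \<beta>], of "\<lambda>q. poly q (1 - u)"] Suc.prems by (simp only: poly_smult)
  also have "\<dots> = (-1) ^ Suc n * poly (weight_diff (\<beta> + 1) (\<alpha> + 1) ?Q) u"
  proof -
    have "((\<alpha> + 1) - (\<alpha> + 1 + (\<beta> + 1)) * (1 - u)) * (e * q) + (1 - u) * (1 - (1 - u)) * - (e * q')
      = - e * (((\<beta> + 1) - (\<beta> + 1 + (\<alpha> + 1)) * u) * q + u * (1 - u) * q')" for e q q' :: real
      by algebra
    from this[of "(-1) ^ n" "poly ?Q u" "poly (pderiv ?Q) u"] show ?thesis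
      unfolding poly_weight_diff IH d by simp
  qed
  also have "\<dots> = real (Suc n) * ((-1) ^ Suc n * poly (jacobi_u (Suc n) \<beta> \<alpha>) u)"
    using arg_cong[OF jacobi_u_Suc[of \<beta> n \<alpha>], of "\<lambda>q. (-1) ^ Suc n * poly q u"] Suc.prems
    by (simp only: poly_smult mult.left_commute)
  finally show ?case by (simp del: of_nat_Suc power_Suc)
qed

subsection \<open>Zeros\<close>

text \<open>Induction over the points in increasing order. The new critical point lies between the
  previous maximum and the new one, and the recorded bound x < \<open>Max A\<close> shows that it
  differs from the earlier ones.\<close>

lemma Rolle_card:
  fixes f :: "real \<Rightarrow> real"
  assumes "finite A" "A \<noteq> {}" "\<And>x. x \<in> A \<Longrightarrow> f x = 0"
    and "A \<subseteq> {a..b}" "continuous_on {a..b} f"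
    and "\<And>x. a < x \<Longrightarrow> x < b \<Longrightarrow> (f has_real_derivative f' x) (at x)"
  shows "\<exists>B. finite B \<and> card A = Suc (card B) \<and> (\<forall>x\<in>B. a < x \<and> x < Max A \<and> f' x = 0)"
  using assms(1-4)
proof (induction A rule: finite_linorder_max_induct)
  case empty
  then show ?case by simp
next
  case (insert c A)
  show ?case
  proof (cases "A = {}")
    case True
    then show ?thesis by (intro exI[of _ "{}"]) auto
  next
    case False
    then obtain B where B: "finite B" "card A = Suc (card B)" "\<forall>x\<in>B. a < x \<and> x < Max A \<and> f' x = 0"
      using insert by auto
    define m where "m = Max A"
    have m: "m \<in> A" "m < c" using False insert by (auto simp: m_def)
    then have mc: "a \<le> m" "c \<le> b" using insert.prems by auto
    have "\<exists>z. m < z \<and> z < c \<and> (\<lambda>h. f' z * h) = (\<lambda>v. 0)"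
    proof (rule Rolle_deriv[OF \<open>m < c\<close>])
      show "f m = f c" using m insert.prems by auto
      show "continuous_on {m..c} f"
        using mc by (intro continuous_on_subset[OF assms(5)]) auto
      show "(f has_derivative (*) (f' x)) (at x)" if "m < x" "x < c" for x
        using assms(6)[of x] that mc by (simp add: has_field_derivative_def)
    qed
    then obtain z where z: "m < z" "z < c" "(\<lambda>h. f' z * h) = (\<lambda>v. 0)" by blast
    from fun_cong[OF z(3), of 1] have "f' z = 0" by simp
    have "Max (insert c A) = c"
      using insert.hyps False by (intro Max_eqI) auto
    moreover have "z \<notin> B" using B z by (auto simp: m_def)
    moreover have "c \<notin> A" using insert.hyps by auto
    ultimately show ?thesis using B z(1,2) \<open>f' z = 0\<close> m mc insert.hyps(1)
      by (intro exI[of _ "insert z B"]) (auto simp: m_def)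
  qed
qed

definition jacobi_roots :: "nat \<Rightarrow> real \<Rightarrow> real \<Rightarrow> real set" where
  "jacobi_roots n \<alpha> \<beta> = {u \<in> {0<..<1}. poly (jacobi_u n \<alpha> \<beta>) u = 0}"

lemma jacobi_u_neq_0:
  assumes "\<alpha> > -1"
  shows "jacobi_u n \<alpha> \<beta> \<noteq> 0" "poly (jacobi_u n \<alpha> \<beta>) 0 > 0"
proof -
  show "poly (jacobi_u n \<alpha> \<beta>) 0 > 0"
    unfolding poly_jacobi_u_at_0 using assms by (intro divide_pos_pos pochhammer_pos) auto
  then show "jacobi_u n \<alpha> \<beta> \<noteq> 0" by auto
qed

lemma finite_jacobi_roots:
  assumes "\<alpha> > -1"
  shows "finite (jacobi_roots n \<alpha> \<beta>)"
  using poly_roots_finite[OF jacobi_u_neq_0(1)[OF assms]]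
  by (rule finite_subset[rotated]) (auto simp: jacobi_roots_def)

text \<open>The degree bounds the count from above. For the lower bound,
  \<open>weight_poly (\<alpha> + 1) (\<beta> + 1) Q\<close> vanishes at 0, at 1 and at the n roots
  of Q, so Rolle's theorem gives n + 1 zeros of its derivative. By Rodrigues' formula these are
  roots of the next polynomial.\<close>

lemma card_jacobi_roots:
  assumes "\<alpha> > -1" "\<beta> > -1"
  shows "card (jacobi_roots n \<alpha> \<beta>) = n"
proof (rule antisym)
  have "card (jacobi_roots n \<alpha> \<beta>) \<le> card {u. poly (jacobi_u n \<alpha> \<beta>) u = 0}"
    by (intro card_mono poly_roots_finite jacobi_u_neq_0 assms) (auto simp: jacobi_roots_def)
  also have "\<dots> \<le> degree (jacobi_u n \<alpha> \<beta>)"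
    by (intro card_poly_roots_bound jacobi_u_neq_0 assms)
  finally show "card (jacobi_roots n \<alpha> \<beta>) \<le> n" using degree_jacobi_u le_trans by blast
next
  show "n \<le> card (jacobi_roots n \<alpha> \<beta>)"
    using assms
  proof (induction n arbitrary: \<alpha> \<beta>)
    case 0
    then show ?case by simp
  next
    case (Suc n)
    let ?Q = "jacobi_u n (\<alpha> + 1) (\<beta> + 1)"
    define f where "f = weight_poly (\<alpha> + 1) (\<beta> + 1) ?Q"
    define f' where "f' = weight_poly (\<alpha> + 1 - 1) (\<beta> + 1 - 1) (weight_diff (\<alpha> + 1) (\<beta> + 1) ?Q)"
    define R where "R = jacobi_roots n (\<alpha> + 1) (\<beta> + 1)"
    define A where "A = insert 0 (insert 1 R)"
    have fin: "finite R" unfolding R_def using Suc.prems by (intro finite_jacobi_roots) auto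
    have "\<exists>B. finite B \<and> card A = Suc (card B) \<and> (\<forall>x\<in>B. 0 < x \<and> x < Max A \<and> f' x = 0)"
    proof (rule Rolle_card)
      show "continuous_on {0..1} f" unfolding f_def using Suc.prems by (intro weight_poly_continuous) auto
      show "(f has_real_derivative f' x) (at x)" if "0 < x" "x < 1" for x
        unfolding f_def f'_def using that by (rule weight_poly_deriv)
      show "f x = 0" if "x \<in> A" for x
        using that by (auto simp: A_def R_def f_def jacobi_roots_def) (auto simp: weight_poly_def)
    qed (use fin in \<open>auto simp: A_def R_def jacobi_roots_def\<close>)
    then obtain B where B: "finite B" "card A = Suc (card B)" "\<forall>x\<in>B. 0 < x \<and> x < Max A \<and> f' x = 0"
      by blast
    have "Max A = 1" using fin by (intro Max_eqI) (auto simp: A_def R_def jacobi_roots_def)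
    have "card A = Suc (Suc (card R))"
      using fin by (auto simp: A_def R_def jacobi_roots_def)
    moreover have "n \<le> card R" unfolding R_def using Suc by simp
    moreover have "B \<subseteq> jacobi_roots (Suc n) \<alpha> \<beta>"
    proof
      fix x assume "x \<in> B"
      with B \<open>Max A = 1\<close> have x: "0 < x" "x < 1" "f' x = 0" by auto
      then have "poly (weight_diff (\<alpha> + 1) (\<beta> + 1) ?Q) x = 0"
        by (simp add: f'_def weight_poly_def)
      then have "poly (smult (real (Suc n)) (jacobi_u (Suc n) \<alpha> \<beta>)) x = 0"
        using jacobi_u_Suc[of \<alpha> n \<beta>] Suc.prems by simp
      with x show "x \<in> jacobi_roots (Suc n) \<alpha> \<beta>" by (simp add: jacobi_roots_def del: of_nat_Suc)
    qed
    then have "card B \<le> card (jacobi_roots (Suc n) \<alpha> \<beta>)"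
      using Suc.prems by (intro card_mono finite_jacobi_roots) auto
    ultimately show ?case using B by simp
  qed
qed

text \<open>Both sides have degree at most n and agree at 0 and at the n roots. Factors normalised
  to 1 at 0 are positive and decreasing left of the first root, which suits the convexity
  argument.\<close>

lemma jacobi_u_factor:
  assumes "\<alpha> > -1" "\<beta> > -1"
  shows "poly (jacobi_u n \<alpha> \<beta>) u
    = poly (jacobi_u n \<alpha> \<beta>) 0 * (\<Prod>z\<in>jacobi_roots n \<alpha> \<beta>. 1 - u / z)"
proof -
  let ?R = "jacobi_roots n \<alpha> \<beta>"
  have fin: "finite ?R" using assms by (intro finite_jacobi_roots)
  define q where "q = smult (poly (jacobi_u n \<alpha> \<beta>) 0) (\<Prod>z\<in>?R. [:1, - (1 / z):])"
  have "degree (\<Prod>z\<in>?R. [:1, - (1 / z):]) \<le> (\<Sum>z\<in>?R. degree [:1, - (1 / z):])"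
    using degree_prod_sum_le[OF fin, of "\<lambda>z. [:1, - (1 / z):]"] by (simp add: o_def)
  also have "\<dots> \<le> (\<Sum>z\<in>?R. 1)" by (intro sum_mono) simp
  finally have "degree q \<le> n" using card_jacobi_roots[OF assms, of n] by (simp add: q_def)
  have "0 \<notin> ?R" by (auto simp: jacobi_roots_def)
  then have c: "card (insert 0 ?R) = Suc n" using fin card_jacobi_roots[OF assms, of n] by simp
  have "jacobi_u n \<alpha> \<beta> = q"
  proof (rule poly_eqI_degree[of "insert 0 ?R"])
    show "poly (jacobi_u n \<alpha> \<beta>) x = poly q x" if "x \<in> insert 0 ?R" for x
    proof (cases "x = 0")
      case True
      then show ?thesis by (simp add: q_def poly_prod)
    next
      case False
      with that have "x \<in> ?R" by simp
      moreover from this have "(\<Prod>z\<in>?R. 1 - x / z) = 0"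
        using fin False by (intro prod_zero) auto
      ultimately show ?thesis by (simp add: q_def poly_prod jacobi_roots_def)
    qed
  qed (use c \<open>degree q \<le> n\<close> degree_jacobi_u[of n \<alpha> \<beta>] in auto)
  then have "poly (jacobi_u n \<alpha> \<beta>) u = poly q u" by simp
  then show ?thesis by (simp add: q_def poly_prod)
qed

subsection \<open>Moments and norms\<close>

lemma weight_poly_cong:
  assumes "0 < u \<Longrightarrow> u < 1 \<Longrightarrow> weight_poly a b p u = weight_poly a' b' q u" "u \<in> {0..1}"
  shows "weight_poly a b p u = weight_poly a' b' q u"
  using assms by (cases "u = 0 \<or> u = 1") auto

lemma weight_poly_shift_right:
  assumes "u \<in> {0..1}"
  shows "weight_poly a b ([:1, -1:] * q) u = weight_poly a (b + 1) q u"
  using assms by (rule weight_poly_cong[rotated]) (simp add: weight_poly_def powr_add algebra_simps)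

lemma weight_poly_monom_mult:
  assumes "u \<in> {0..1}"
  shows "weight_poly a b (monom c k * q) u = c * weight_poly (a + real k) b q u"
proof (cases "u = 0")
  case False
  then show ?thesis using assms
    by (simp add: weight_poly_def poly_monom powr_add powr_realpow)
qed simp

text \<open>The integrand is the derivative of \<open>weight_poly a b q\<close>, which vanishes at
  both ends and is continuous up to them because a, b > 0. The integrand itself may be
  unbounded.\<close>

lemma weight_poly_ibp:
  assumes "a > 0" "b > 0"
  shows "(weight_poly (a - 1) (b - 1) (weight_diff a b q) has_integral 0) {0..1}"
proof -
  have "(weight_poly (a - 1) (b - 1) (weight_diff a b q) has_integral weight_poly a b q 1 - weight_poly a b q 0) {0..1}"
  proof (rule fundamental_theorem_of_calculus_interior)
    show "continuous_on {0..1} (weight_poly a b q)" using assms by (rule weight_poly_continuous)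
    show "(weight_poly a b q has_vector_derivative weight_poly (a - 1) (b - 1) (weight_diff a b q) x) (at x)"
      if "x \<in> {0<..<1}" for x
      using weight_poly_deriv that by (simp add: has_real_derivative_iff_has_vector_derivative)
  qed simp
  then show ?thesis by simp
qed

text \<open>With \<gamma> free, one formula yields orthogonality (the rising factorial vanishes for
  \<gamma> = \<alpha>, ..., \<alpha> + n - 1) and also covers the singular exponent \<gamma> =
  \<alpha> - 1. In the induction the Rodrigues operator for \<alpha> is replaced by the one for
  \<gamma>, whose integral is zero; the difference is (\<alpha> - \<gamma>)(1 - u) Q.\<close>

lemma jacobi_u_moment:
  assumes "\<alpha> > -1" "\<beta> > -1" "\<gamma> > -1"
  shows "(weight_poly \<gamma> \<beta> (jacobi_u n \<alpha> \<beta>) has_integral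
    pochhammer (\<alpha> - \<gamma>) n / fact n * Beta (\<gamma> + 1) (real n + \<beta> + 1)) {0..1}"
  using assms
proof (induction n arbitrary: \<alpha> \<beta>)
  case 0
  then show ?case using has_integral_Beta_real[of "\<gamma> + 1" "\<beta> + 1"]
    by (simp add: weight_poly_def[abs_def])
next
  case (Suc n)
  let ?Q = "jacobi_u n (\<alpha> + 1) (\<beta> + 1)"
  define I where "I = pochhammer (\<alpha> + 1 - \<gamma>) n / fact n * Beta (\<gamma> + 1) (real n + \<beta> + 2)"
  have "(weight_poly (\<gamma> + 1 - 1) (\<beta> + 1 - 1) (weight_diff (\<gamma> + 1) (\<beta> + 1) ?Q) has_integral 0) {0..1}"
    using Suc.prems by (intro weight_poly_ibp) auto
  moreover have "(weight_poly \<gamma> (\<beta> + 1) ?Q has_integral I) {0..1}"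
    using Suc.IH[of "\<alpha> + 1" "\<beta> + 1"] Suc.prems by (simp add: I_def add_ac)
  ultimately have *: "((\<lambda>u. (weight_poly \<gamma> \<beta> (weight_diff (\<gamma> + 1) (\<beta> + 1) ?Q) u
      - (\<gamma> - \<alpha>) * weight_poly \<gamma> (\<beta> + 1) ?Q u) / real (Suc n)) has_integral (0 - (\<gamma> - \<alpha>) * I) / real (Suc n)) {0..1}"
    by (intro has_integral_divide has_integral_diff has_integral_mult_right) simp_all
  have "(weight_poly \<gamma> \<beta> (jacobi_u (Suc n) \<alpha> \<beta>) has_integral (0 - (\<gamma> - \<alpha>) * I) / real (Suc n)) {0..1}"
  proof (rule has_integral_eq[OF _ *])
    fix u :: real assume u: "u \<in> {0..1}"
    have "real (Suc n) * poly (jacobi_u (Suc n) \<alpha> \<beta>) u = poly (weight_diff (\<alpha> + 1) (\<beta> + 1) ?Q) u"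
      using arg_cong[OF jacobi_u_Suc[of \<alpha> n \<beta>], of "\<lambda>q. poly q u"] Suc.prems by (simp only: poly_smult)
    then have p: "poly (jacobi_u (Suc n) \<alpha> \<beta>) u = poly (weight_diff (\<alpha> + 1) (\<beta> + 1) ?Q) u / real (Suc n)"
      by (simp add: field_simps)
    have "(weight_poly \<gamma> \<beta> (weight_diff (\<gamma> + 1) (\<beta> + 1) ?Q) u - (\<gamma> - \<alpha>) * weight_poly \<gamma> (\<beta> + 1) ?Q u)
      = weight_poly \<gamma> \<beta> (weight_diff (\<alpha> + 1) (\<beta> + 1) ?Q) u"
      unfolding weight_poly_shift_right[OF u, symmetric]
      unfolding weight_poly_def poly_weight_diff by (simp add: algebra_simps)
    then show "(weight_poly \<gamma> \<beta> (weight_diff (\<gamma> + 1) (\<beta> + 1) ?Q) u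
      - (\<gamma> - \<alpha>) * weight_poly \<gamma> (\<beta> + 1) ?Q u) / real (Suc n) = weight_poly \<gamma> \<beta> (jacobi_u (Suc n) \<alpha> \<beta>) u"
      unfolding weight_poly_def p by simp
  qed
  moreover have "(0 - (\<gamma> - \<alpha>) * I) / real (Suc n)
    = pochhammer (\<alpha> - \<gamma>) (Suc n) / fact (Suc n) * Beta (\<gamma> + 1) (real (Suc n) + \<beta> + 1)"
  proof -
    have e: "real (Suc n) + \<beta> + 1 = real n + \<beta> + 2" "\<alpha> - \<gamma> + 1 = \<alpha> + 1 - \<gamma>" by simp_all
    show ?thesis unfolding I_def pochhammer_rec fact_Suc e
      by (simp add: field_simps del: of_nat_Suc)
  qed
  ultimately show ?case by simp
qed

text \<open>Expanding only one factor into monomials reduces integrals of p^2 to moments of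
  p.\<close>

lemma weight_poly_mult_has_integral:
  assumes "degree q \<le> n"
    and "\<And>k. k \<le> n \<Longrightarrow> (weight_poly (a + real k) b p has_integral I k) {0..1}"
  shows "(weight_poly a b (q * p) has_integral (\<Sum>k\<le>n. coeff q k * I k)) {0..1}"
proof (rule has_integral_eq)
  show "((\<lambda>u. \<Sum>k\<le>n. coeff q k * weight_poly (a + real k) b p u) has_integral (\<Sum>k\<le>n. coeff q k * I k)) {0..1}"
    using assms(2) by (intro has_integral_sum has_integral_mult_right) auto
  fix u :: real assume u: "u \<in> {0..1}"
  have "(\<Sum>k\<le>n. coeff q k * weight_poly (a + real k) b p u) = (\<Sum>k\<le>n. weight_poly a b (monom (coeff q k) k * p) u)"
    using weight_poly_monom_mult[OF u] by simp
  also have "\<dots> = weight_poly a b ((\<Sum>k\<le>n. monom (coeff q k) k) * p) u"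
    by (simp add: weight_poly_def poly_sum sum_distrib_left sum_distrib_right mult_ac)
  also have "(\<Sum>k\<le>n. monom (coeff q k) k) = q" using assms(1) by (rule poly_as_sum_of_monoms')
  finally show "(\<Sum>k\<le>n. coeff q k * weight_poly (a + real k) b p u) = weight_poly a b (q * p) u" .
qed

section \<open>The normalising constant and the weighted integrals of p^2\<close>

definition jacobi_norm :: "nat \<Rightarrow> real \<Rightarrow> real \<Rightarrow> real" where
  "jacobi_norm n \<alpha> \<beta> = Gamma (real n + 1) * Gamma (real n + \<alpha> + \<beta> + 1)
           / (Gamma (real n + \<alpha> + 1) * Gamma (real n + \<beta> + 1))"

lemma jacobi_norm_commute: "jacobi_norm n \<alpha> \<beta> = jacobi_norm n \<beta> \<alpha>"
  by (simp add: jacobi_norm_def add_ac mult_ac)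

lemma jacobi_norm_pos: "\<alpha> > 0 \<Longrightarrow> \<beta> > 0 \<Longrightarrow> jacobi_norm n \<alpha> \<beta> > 0"
  unfolding jacobi_norm_def by (intro divide_pos_pos mult_pos_pos Gamma_real_pos) auto

lemma pochhammer_Gamma_pos:
  assumes "x > (0::real)"
  shows "pochhammer x n = Gamma (x + real n) / Gamma x"
proof (rule pochhammer_Gamma)
  show "x \<notin> \<int>\<^sub>\<le>\<^sub>0" using assms by (auto elim!: nonpos_Ints_cases)
qed

lemma Gamma_plus1_pos: "x > (0::real) \<Longrightarrow> Gamma (x + 1) = x * Gamma x"
  by (intro Gamma_plus1) (auto elim!: nonpos_Ints_cases)

lemma jacobi_integral_left:
  assumes "\<alpha> > 0" "\<beta> > 0"
  shows "(weight_poly (\<alpha> - 1) \<beta> (jacobi_u n \<alpha> \<beta> * jacobi_u n \<alpha> \<beta>)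
    has_integral 1 / (\<alpha> * jacobi_norm n \<alpha> \<beta>)) {0..1}"
proof -
  let ?p = "jacobi_u n \<alpha> \<beta>"
  \<comment> \<open>Against u^(\<alpha> - 1 + k) the moment carries the rising factorial of 1 - k,
    which vanishes for 1 <= k <= n, so only the constant coefficient contributes.\<close>
  define I where "I k = (if k = 0 then Beta \<alpha> (real n + \<beta> + 1) else 0)" for k :: nat
  have "(weight_poly (\<alpha> - 1) \<beta> (?p * ?p) has_integral (\<Sum>k\<le>n. coeff ?p k * I k)) {0..1}"
  proof (rule weight_poly_mult_has_integral[OF degree_jacobi_u])
    fix k :: nat assume "k \<le> n"
    have "pochhammer (\<alpha> - (\<alpha> - 1 + real k)) n / fact n * Beta (\<alpha> - 1 + real k + 1) (real n + \<beta> + 1) = I k"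
    proof (cases k)
      case 0
      then show ?thesis by (simp add: I_def pochhammer_fact[symmetric])
    next
      case (Suc j)
      then have "pochhammer (- real j) n = 0" using \<open>k \<le> n\<close> by (simp add: pochhammer_of_nat_eq_0_iff)
      with Suc show ?thesis by (simp add: I_def)
    qed
    then show "(weight_poly (\<alpha> - 1 + real k) \<beta> ?p has_integral I k) {0..1}"
      using jacobi_u_moment[of \<alpha> \<beta> "\<alpha> - 1 + real k" n] assms by simp
  qed
  moreover have "(\<Sum>k\<le>n. coeff ?p k * I k) = coeff ?p 0 * Beta \<alpha> (real n + \<beta> + 1)"
    by (simp add: I_def if_distrib sum.delta cong: if_cong)
  moreover have "coeff ?p 0 = Gamma (real n + \<alpha> + 1) / (\<alpha> * Gamma \<alpha>) / Gamma (real n + 1)"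
    using poly_jacobi_u_at_0[of n \<alpha> \<beta>] pochhammer_Gamma_pos[of "\<alpha> + 1" n] Gamma_plus1_pos[of \<alpha>]
      Gamma_fact[of n, where ?'a = real] assms
    by (simp add: poly_0_coeff_0 add_ac)
  moreover have "Gamma \<alpha> > 0" "Gamma (real n + \<alpha> + 1) > 0" "Gamma (real n + \<beta> + 1) > 0" "Gamma (real n + 1) > 0"
     "Gamma (real n + \<alpha> + \<beta> + 1) > 0"
    using assms by (auto intro!: Gamma_real_pos)
  moreover have "\<alpha> + (real n + \<beta> + 1) = real n + \<alpha> + \<beta> + 1" by simp
  ultimately show ?thesis using assms
    by (simp add: jacobi_norm_def Beta_def mult.assoc)
qed

lemma jacobi_integral_mid:
  assumes "\<alpha> > 0" "\<beta> > 0"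
  shows "(weight_poly \<alpha> \<beta> (jacobi_u n \<alpha> \<beta> * jacobi_u n \<alpha> \<beta>)
    has_integral 1 / ((2 * real n + \<alpha> + \<beta> + 1) * jacobi_norm n \<alpha> \<beta>)) {0..1}"
proof -
  let ?p = "jacobi_u n \<alpha> \<beta>"
  \<comment> \<open>Here the rising factorial of -k vanishes for k < n, so only the leading
    coefficient contributes; its sign cancels that of the moment.\<close>
  define I where "I k = (if k = n then (-1) ^ n * Beta (\<alpha> + real n + 1) (real n + \<beta> + 1) else 0)" for k :: nat
  have "(weight_poly \<alpha> \<beta> (?p * ?p) has_integral (\<Sum>k\<le>n. coeff ?p k * I k)) {0..1}"
  proof (rule weight_poly_mult_has_integral[OF degree_jacobi_u])
    fix k :: nat assume "k \<le> n"
    have "pochhammer (\<alpha> - (\<alpha> + real k)) n / fact n * Beta (\<alpha> + real k + 1) (real n + \<beta> + 1) = I k"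
    proof (cases "k = n")
      case True
      then show ?thesis by (simp add: I_def pochhammer_same)
    next
      case False
      then have "pochhammer (- real k) n = 0" using \<open>k \<le> n\<close> by (simp add: pochhammer_of_nat_eq_0_iff)
      with False show ?thesis by (simp add: I_def)
    qed
    then show "(weight_poly (\<alpha> + real k) \<beta> ?p has_integral I k) {0..1}"
      using jacobi_u_moment[of \<alpha> \<beta> "\<alpha> + real k" n] assms by simp
  qed
  moreover have "(\<Sum>k\<le>n. coeff ?p k * I k) = coeff ?p n * ((-1) ^ n * Beta (\<alpha> + real n + 1) (real n + \<beta> + 1))"
    by (simp add: I_def if_distrib sum.delta cong: if_cong)
  moreover have "coeff ?p n = (-1) ^ n * (Gamma (2 * real n + \<alpha> + \<beta> + 1) / Gamma (real n + \<alpha> + \<beta> + 1)) / Gamma (real n + 1)"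
    using jacobi_coef_lead[of \<alpha> n \<beta>] pochhammer_Gamma_pos[of "real n + \<alpha> + \<beta> + 1" n]
      Gamma_fact[of n, where ?'a = real] assms
    by (simp add: coeff_jacobi_u add_ac)
  moreover have "Gamma (real n * 2 + \<alpha> + \<beta> + 1) > 0" "Gamma (real n + \<alpha> + 1) > 0" "Gamma (real n + \<beta> + 1) > 0" "Gamma (real n + 1) > 0"
     "Gamma (real n + \<alpha> + \<beta> + 1) > 0"
    using assms by (auto intro!: Gamma_real_pos)
  moreover have "Beta (\<alpha> + real n + 1) (real n + \<beta> + 1) = Gamma (real n + \<alpha> + 1) * Gamma (real n + \<beta> + 1)
    / ((2 * real n + \<alpha> + \<beta> + 1) * Gamma (2 * real n + \<alpha> + \<beta> + 1))"
  proof -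
    have e1: "\<alpha> + real n + 1 + (real n + \<beta> + 1) = (2 * real n + \<alpha> + \<beta> + 1) + 1"
      and e2: "\<alpha> + real n + 1 = real n + \<alpha> + 1"
      by simp_all
    have e3: "Gamma ((2 * real n + \<alpha> + \<beta> + 1) + 1) = (2 * real n + \<alpha> + \<beta> + 1) * Gamma (2 * real n + \<alpha> + \<beta> + 1)"
      using assms by (intro Gamma_plus1_pos) auto
    show ?thesis unfolding Beta_def e1 unfolding e2 e3 ..
  qed
  moreover have "(-1) ^ n * ((-1) ^ n * x) = (x::real)" for x
    by (simp flip: mult.assoc power_mult_distrib)
  ultimately show ?thesis using assms
    by (simp add: jacobi_norm_def mult_ac)
qed

lemma weight_poly_reflect:
  assumes "\<alpha> > -1" "\<beta> > -1"
  shows "weight_poly a b (jacobi_u n \<alpha> \<beta>) (1 - u) = (-1) ^ n * weight_poly b a (jacobi_u n \<beta> \<alpha>) u"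
  unfolding weight_poly_def jacobi_u_reflect[OF assms] by simp

lemma has_integral_unit_reflect:
  fixes f :: "real \<Rightarrow> real"
  assumes "(f has_integral i) {0..1}"
  shows "((\<lambda>u. f (1 - u)) has_integral i) {0..1}"
  using has_integral_affinity[of f i 0 1 "-1" 1] assms by (simp add: o_def)

lemma jacobi_integral_right:
  assumes "\<alpha> > 0" "\<beta> > 0"
  shows "(weight_poly \<alpha> (\<beta> - 1) (jacobi_u n \<alpha> \<beta> * jacobi_u n \<alpha> \<beta>)
    has_integral 1 / (\<beta> * jacobi_norm n \<alpha> \<beta>)) {0..1}"
proof -
  have "((\<lambda>u. weight_poly (\<beta> - 1) \<alpha> (jacobi_u n \<beta> \<alpha> * jacobi_u n \<beta> \<alpha>) (1 - u)) has_integral 1 / (\<beta> * jacobi_norm n \<beta> \<alpha>)) {0..1}"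
    using assms by (intro has_integral_unit_reflect jacobi_integral_left)
  moreover have "weight_poly (\<beta> - 1) \<alpha> (jacobi_u n \<beta> \<alpha> * jacobi_u n \<beta> \<alpha>) (1 - u)
      = weight_poly \<alpha> (\<beta> - 1) (jacobi_u n \<alpha> \<beta> * jacobi_u n \<alpha> \<beta>) u" for u
    using assms jacobi_u_reflect[of \<beta> \<alpha> n u]
    by (simp add: weight_poly_def flip: power_mult_distrib power_add)
  ultimately show ?thesis using jacobi_norm_commute by simp
qed

subsection \<open>The first peak\<close>

text \<open>Convexity alone is not inherited by products; with monotonicity and nonnegativity added,
  the class is closed under them.\<close>

definition convex_decreasing_on :: "real set \<Rightarrow> (real \<Rightarrow> real) \<Rightarrow> bool" where
  "convex_decreasing_on S f \<longleftrightarrow> convex_on S f \<and> (\<forall>x\<in>S. \<forall>y\<in>S. x \<le> y \<longrightarrow> f y \<le> f x) \<and> (\<forall>x\<in>S. 0 \<le> f x)"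

text \<open>The product of the two chords is the chord of the product minus u v (f x - f y)(g x - g
  y), and this term is nonnegative because both functions decrease.\<close>

lemma convex_decreasing_on_mult:
  assumes "convex_decreasing_on S f" "convex_decreasing_on S g"
  shows "convex_decreasing_on S (\<lambda>x. f x * g x)"
  unfolding convex_decreasing_on_def
proof (intro conjI ballI impI)
  show "convex_on S (\<lambda>x. f x * g x)"
    unfolding convex_on_def
  proof (intro conjI ballI allI impI)
    show "convex S" using assms(1) by (simp add: convex_decreasing_on_def convex_on_def)
    fix x y u v :: real assume xy: "x \<in> S" "y \<in> S" and uv: "0 \<le> u" "0 \<le> v" "u + v = 1"
    have z: "u *\<^sub>R x + v *\<^sub>R y \<in> S" using \<open>convex S\<close> xy uv by (rule convexD)
    have "f (u *\<^sub>R x + v *\<^sub>R y) * g (u *\<^sub>R x + v *\<^sub>R y) \<le> (u * f x + v * f y) * (u * g x + v * g y)"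
      using assms xy uv z by (intro mult_mono) (auto simp: convex_decreasing_on_def convex_on_def)
    also have "\<dots> = u * (f x * g x) + v * (f y * g y) - u * v * ((f x - f y) * (g x - g y))"
    proof -
      have v: "v = 1 - u" using uv by simp
      show ?thesis unfolding v by algebra
    qed
    also have "\<dots> \<le> u * (f x * g x) + v * (f y * g y)"
    proof -
      have "(f x - f y) * (g x - g y) \<ge> 0"
        using assms xy by (cases "x \<le> y") (auto simp: convex_decreasing_on_def zero_le_mult_iff)
      then show ?thesis using uv by simp
    qed
    finally show "f (u *\<^sub>R x + v *\<^sub>R y) * g (u *\<^sub>R x + v *\<^sub>R y) \<le> u * (f x * g x) + v * (f y * g y)" .
  qed
  show "f y * g y \<le> f x * g x" if "x \<in> S" "y \<in> S" "x \<le> y" for x y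
    using assms that by (intro mult_mono) (auto simp: convex_decreasing_on_def)
  show "0 \<le> f x * g x" if "x \<in> S" for x
    using assms that by (auto simp: convex_decreasing_on_def)
qed

lemma convex_decreasing_on_linear:
  assumes "0 < m" "m \<le> z"
  shows "convex_decreasing_on {0..m} (\<lambda>u. 1 - u / z)"
proof -
  have "convex_on {0..m} (\<lambda>u. 1 - u / z)"
    by (rule f''_ge0_imp_convex[where f' = "\<lambda>u. - 1 / z" and f'' = "\<lambda>u. 0"])
       (use assms in \<open>auto intro!: derivative_eq_intros\<close>)
  with assms show ?thesis by (auto simp: convex_decreasing_on_def field_simps)
qed

text \<open>For 0 < c < 1 the power (1 - u)^c alone is concave, so it is treated together with the
  linear factor of the first root m.\<close>

lemma convex_decreasing_on_powr_linear:
  assumes "0 < m" "m < 1" "0 \<le> c"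
  shows "convex_decreasing_on {0..m} (\<lambda>u. (1 - u) powr c * (1 - u / m))"
  unfolding convex_decreasing_on_def
proof (intro conjI ballI impI)
  show "convex_on {0..m} (\<lambda>u. (1 - u) powr c * (1 - u / m))"
  proof (rule f''_ge0_imp_convex[where
        f' = "\<lambda>u. - c * (1 - u) powr (c - 1) * (1 - u / m) - (1 - u) powr c / m" and
        f'' = "\<lambda>u. c * (1 - u) powr (c - 2) * ((c - 1) * (1 - u / m) + 2 * (1 - u) / m)"])
    fix u assume u: "u \<in> {0..m}"
    then have u1: "u < 1" using assms by auto
    then have pos: "1 - u > 0" by simp
    show "((\<lambda>u. (1 - u) powr c * (1 - u / m)) has_real_derivative
        - c * (1 - u) powr (c - 1) * (1 - u / m) - (1 - u) powr c / m) (at u)"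
      using u1 assms by (auto intro!: derivative_eq_intros simp: powr_diff divide_simps)
    show "((\<lambda>u. - c * (1 - u) powr (c - 1) * (1 - u / m) - (1 - u) powr c / m) has_real_derivative
        c * (1 - u) powr (c - 2) * ((c - 1) * (1 - u / m) + 2 * (1 - u) / m)) (at u)"
    proof -
      define w where "w = (1 - u) powr (c - 2)"
      have w: "(1 - u) powr (c - 1) = w * (1 - u)" "(1 - u) powr c = w * (1 - u)\<^sup>2"
        "(1 - u) powr (c - 1 - 1) = w"
        unfolding w_def using pos by (simp_all add: powr_diff power2_eq_square)
      have d: "((\<lambda>u. (1 - u) powr r) has_real_derivative - (r * (1 - u) powr (r - 1))) (at u)" for r
        using pos by (auto intro!: derivative_eq_intros)
      have l: "((\<lambda>u. 1 - u / m) has_real_derivative - 1 / m) (at u)"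
        using assms by (auto intro!: derivative_eq_intros)
      have "((\<lambda>u. - c * ((1 - u) powr (c - 1) * (1 - u / m)) - (1 - u) powr c / m) has_real_derivative
        - c * ((- ((c - 1) * (1 - u) powr (c - 1 - 1))) * (1 - u / m) + (- 1 / m) * (1 - u) powr (c - 1))
        - (- (c * (1 - u) powr (c - 1))) / m) (at u)"
        by (intro DERIV_diff DERIV_cmult DERIV_mult d l DERIV_cdivide)
      moreover have "(\<lambda>u. - c * ((1 - u) powr (c - 1) * (1 - u / m)) - (1 - u) powr c / m)
        = (\<lambda>u. - c * (1 - u) powr (c - 1) * (1 - u / m) - (1 - u) powr c / m)" by (simp add: mult.assoc)
      moreover have "- c * ((- ((c - 1) * (1 - u) powr (c - 1 - 1))) * (1 - u / m) + (- 1 / m) * (1 - u) powr (c - 1))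
        - (- (c * (1 - u) powr (c - 1))) / m = c * w * ((c - 1) * (1 - u / m) + 2 * (1 - u) / m)"
        unfolding w using assms by (simp add: divide_simps) algebra
      ultimately show ?thesis by (simp only: w_def)
    qed
    \<comment> \<open>Here m < 1 enters: this inequality absorbs the negative term -(1 - u/m) in the
      bracket of the second derivative.\<close>
    have "(1 - u) / m \<ge> 1 - u / m" using assms by (simp add: field_simps)
    moreover have "1 - u / m \<ge> 0" "c * (1 - u / m) \<ge> 0" using u assms by (auto intro!: mult_nonneg_nonneg)
    moreover have "(c - 1) * (1 - u / m) + 2 * (1 - u) / m = c * (1 - u / m) - (1 - u / m) + (1 - u) / m + (1 - u) / m"
      by (simp add: left_diff_distrib)
    ultimately have "(c - 1) * (1 - u / m) + 2 * (1 - u) / m \<ge> 0" by linarith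
    then show "0 \<le> c * (1 - u) powr (c - 2) * ((c - 1) * (1 - u / m) + 2 * (1 - u) / m)"
      using assms by (intro mult_nonneg_nonneg) auto
  qed simp
  show "(1 - y) powr c * (1 - y / m) \<le> (1 - x) powr c * (1 - x / m)"
    if "x \<in> {0..m}" "y \<in> {0..m}" "x \<le> y" for x y
    using that assms by (intro mult_mono powr_mono2) (auto simp: field_simps)
  show "0 \<le> (1 - x) powr c * (1 - x / m)" if "x \<in> {0..m}" for x
    using that assms by (auto simp: field_simps)
qed

text \<open>The smallest root is split off to accompany the power; the other linear factors are
  convex, decreasing and nonnegative on their own, as their roots are at least
  \<open>Min Z\<close>.\<close>

lemma convex_on_powr_prod_linear:
  assumes "finite Z" "Z \<noteq> {}" "Z \<subseteq> {0<..<1}" "0 \<le> c"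
  shows "convex_on {0..Min Z} (\<lambda>u. (1 - u) powr c * (\<Prod>z\<in>Z. 1 - u / z))"
proof -
  define m where "m = Min Z"
  have m: "m \<in> Z" using assms by (simp add: m_def)
  then have m01: "0 < m" "m < 1" using assms by auto
  have "convex_decreasing_on {0..m} (\<lambda>u. \<Prod>z\<in>A. 1 - u / z)" if "finite A" "A \<subseteq> Z" for A
    using that
  proof induction
    case empty
    then show ?case by (simp add: convex_decreasing_on_def convex_on_const)
  next
    case (insert z A)
    then have "m \<le> z" using assms by (simp add: m_def)
    with insert show ?case
      using convex_decreasing_on_mult[OF convex_decreasing_on_linear[OF m01(1)]] by simp
  qed
  from convex_decreasing_on_mult[OF convex_decreasing_on_powr_linear[OF m01 assms(4)] this[of "Z - {m}"]] assms(1)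
  have "convex_decreasing_on {0..m} (\<lambda>u. (1 - u) powr c * (1 - u / m) * (\<Prod>z\<in>Z - {m}. 1 - u / z))" by simp
  also have "(\<lambda>u. (1 - u) powr c * (1 - u / m) * (\<Prod>z\<in>Z - {m}. 1 - u / z))
      = (\<lambda>u. (1 - u) powr c * (\<Prod>z\<in>Z. 1 - u / z))"
    using prod.remove[OF assms(1) m, of "\<lambda>z. 1 - _ / z"] by (simp add: mult.assoc)
  finally show ?thesis by (simp add: convex_decreasing_on_def m_def)
qed

lemma jacobi_roots_nonempty:
  assumes "\<alpha> > -1" "\<beta> > -1" "n \<ge> 1"
  shows "jacobi_roots n \<alpha> \<beta> \<noteq> {}"
  using card_jacobi_roots[OF assms(1,2), of n] assms(3) by auto

lemma Min_jacobi_roots: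
  assumes "\<alpha> > -1" "\<beta> > -1" "n \<ge> 1"
  defines "m \<equiv> Min (jacobi_roots n \<alpha> \<beta>)"
  shows "0 < m" "m < 1" "poly (jacobi_u n \<alpha> \<beta>) m = 0" "\<And>u. 0 \<le> u \<Longrightarrow> u < m \<Longrightarrow> poly (jacobi_u n \<alpha> \<beta>) u > 0"
proof -
  let ?Z = "jacobi_roots n \<alpha> \<beta>"
  have fin: "finite ?Z" using assms by (intro finite_jacobi_roots)
  then have "m \<in> ?Z" unfolding m_def using jacobi_roots_nonempty assms by (intro Min_in) auto
  then show "0 < m" "m < 1" "poly (jacobi_u n \<alpha> \<beta>) m = 0" by (auto simp: jacobi_roots_def)
  fix u assume u: "0 \<le> u" "u < m"
  have "m \<le> z" if "z \<in> ?Z" for z using fin that by (simp add: m_def)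
  then have "(\<Prod>z\<in>?Z. 1 - u / z) > 0"
    using u \<open>0 < m\<close> by (intro prod_pos) (force simp: field_simps)
  then show "poly (jacobi_u n \<alpha> \<beta>) u > 0"
    using jacobi_u_factor[of \<alpha> \<beta> n u] jacobi_u_neq_0(2)[of \<alpha> n \<beta>] assms by simp
qed

text \<open>The square is insensitive to sign, and its derivative 2 y y' vanishes only with y' where
  y is nonzero. Maximality is asked only on a window (a, b), so the lemma serves both the first peak
  and the global one.\<close>

lemma weight_poly_critical:
  assumes "a < u" "u < b" "0 \<le> a" "b \<le> 1" "weight_poly c d q u \<noteq> 0"
    and max: "\<And>v. a < v \<Longrightarrow> v < b \<Longrightarrow> (weight_poly c d q v)\<^sup>2 \<le> (weight_poly c d q u)\<^sup>2"
  shows "poly (weight_diff c d q) u = 0"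
proof -
  have u: "0 < u" "u < 1" using assms by auto
  have "((\<lambda>v. (weight_poly c d q v)\<^sup>2) has_real_derivative
      2 * weight_poly c d q u * weight_poly (c - 1) (d - 1) (weight_diff c d q) u) (at u)"
    using weight_poly_deriv[OF u, of c d q] by (auto intro!: derivative_eq_intros)
  then have "2 * weight_poly c d q u * weight_poly (c - 1) (d - 1) (weight_diff c d q) u = 0"
  proof (rule DERIV_local_max)
    show "0 < min (u - a) (b - u)" using assms by simp
    show "\<forall>v. \<bar>u - v\<bar> < min (u - a) (b - u) \<longrightarrow> (weight_poly c d q v)\<^sup>2 \<le> (weight_poly c d q u)\<^sup>2"
      using max by auto
  qed
  with assms(5) u show ?thesis by (simp add: weight_poly_def)
qed

section \<open>The first peak and its bound by \<open>R_star\<close>\<close>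

lemma R_star_pos: "a > 0 \<Longrightarrow> R_star a > 0"
  by (simp add: R_star_def)

text \<open>This is the squared tangent line integrated up to its zero h/k against the singular
  weight; it is the source of the rational factor in \<open>R_star\<close>.\<close>

lemma has_integral_powr_times_square:
  fixes a h k :: real
  assumes "a > 0" "h > 0" "k > 0"
  shows "((\<lambda>u. u powr (a - 1) * (h - k * u)\<^sup>2) has_integral
     (h / k) powr a * h\<^sup>2 * (2 / (a * (a + 1) * (a + 2)))) {0..h / k}"
proof -
  define F where "F u = u powr a * (h\<^sup>2 / a - 2 * h * k * u / (a + 1) + k\<^sup>2 * u\<^sup>2 / (a + 2))" for u
  have "((\<lambda>u. u powr (a - 1) * (h - k * u)\<^sup>2) has_integral F (h / k) - F 0) {0..h / k}"
  proof (rule fundamental_theorem_of_calculus_interior)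
    show "continuous_on {0..h / k} F"
      unfolding F_def using assms by (intro continuous_intros continuous_on_powr') auto
    fix u assume "u \<in> {0<..<h / k}"
    then have u: "u > 0" by simp
    define w where "w = u powr (a - 1)"
    have w: "u powr a = w * u" using u by (simp add: w_def powr_diff)
    have "(F has_real_derivative a * w * (h\<^sup>2 / a - 2 * h * k * u / (a + 1) + k\<^sup>2 * u\<^sup>2 / (a + 2))
      + u powr a * (- 2 * h * k / (a + 1) + k\<^sup>2 * (2 * u) / (a + 2))) (at u)"
      unfolding F_def w_def using u assms by (auto intro!: derivative_eq_intros)
    also have "a * w * (h\<^sup>2 / a - 2 * h * k * u / (a + 1) + k\<^sup>2 * u\<^sup>2 / (a + 2))
      + u powr a * (- 2 * h * k / (a + 1) + k\<^sup>2 * (2 * u) / (a + 2)) = w * (h - k * u)\<^sup>2"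
    proof -
      define A X Y where "A = h\<^sup>2 / a" and "X = 2 * h * k / (a + 1)" and "Y = k\<^sup>2 / (a + 2)"
      have "a * A = h\<^sup>2" "(a + 1) * X = 2 * h * k" "(a + 2) * Y = k\<^sup>2" using assms by (auto simp: A_def X_def Y_def)
      then have "a * w * (A - X * u + Y * u\<^sup>2) + w * u * (- X + Y * (2 * u)) = w * (h - k * u)\<^sup>2"
        by algebra
      then show ?thesis unfolding w A_def X_def Y_def by simp
    qed
    finally show "(F has_vector_derivative u powr (a - 1) * (h - k * u)\<^sup>2) (at u)"
      by (simp add: has_real_derivative_iff_has_vector_derivative w_def)
  qed (use assms in simp)
  moreover have "F (h / k) - F 0 = (h / k) powr a * h\<^sup>2 * (2 / (a * (a + 1) * (a + 2)))"
  proof -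
    have "h\<^sup>2 / a - 2 * h * k * (h / k) / (a + 1) + k\<^sup>2 * (h / k)\<^sup>2 / (a + 2) = h\<^sup>2 * (1 / a - 2 / (a + 1) + 1 / (a + 2))"
      using assms by (simp add: power2_eq_square algebra_simps)
    also have "1 / a - 2 / (a + 1) + 1 / (a + 2) = 2 / (a * (a + 1) * (a + 2))"
      using assms by (simp add: divide_simps) (simp add: algebra_simps)
    finally show ?thesis by (simp add: F_def)
  qed
  ultimately show ?thesis by simp
qed

definition jacobi_y :: "nat \<Rightarrow> real \<Rightarrow> real \<Rightarrow> real \<Rightarrow> real" where
  "jacobi_y n \<alpha> \<beta> = weight_poly (\<alpha> / 2) (\<beta> / 2) (jacobi_u n \<alpha> \<beta>)"

lemma jacobi_y_continuous: "\<alpha> > 0 \<Longrightarrow> \<beta> > 0 \<Longrightarrow> continuous_on {0..1} (jacobi_y n \<alpha> \<beta>)"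
  unfolding jacobi_y_def by (intro weight_poly_continuous) auto

lemma jacobi_y_reflect:
  assumes "\<alpha> > 0" "\<beta> > 0"
  shows "jacobi_y n \<alpha> \<beta> (1 - u) = (-1) ^ n * jacobi_y n \<beta> \<alpha> u"
  unfolding jacobi_y_def using assms by (intro weight_poly_reflect) auto

text \<open>Since y vanishes at 0 and at the first root and is positive in between, the maximum of
  y^2 over this interval is attained in the interior.\<close>

lemma jacobi_first_peak_exists:
  assumes "\<alpha> > 0" "\<beta> > 0" "n \<ge> 1"
  defines "m \<equiv> Min (jacobi_roots n \<alpha> \<beta>)"
  obtains s where "0 < s" "s < m" "jacobi_y n \<alpha> \<beta> s > 0"
    "poly (weight_diff (\<alpha> / 2) (\<beta> / 2) (jacobi_u n \<alpha> \<beta>)) s = 0"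
    "\<And>v. 0 \<le> v \<Longrightarrow> v \<le> m \<Longrightarrow> (jacobi_y n \<alpha> \<beta> v)\<^sup>2 \<le> (jacobi_y n \<alpha> \<beta> s)\<^sup>2"
proof -
  let ?y = "jacobi_y n \<alpha> \<beta>"
  have ab: "\<alpha> > -1" "\<beta> > -1" using assms by auto
  note m = Min_jacobi_roots[OF ab assms(3), folded m_def]
  have "continuous_on {0..m} (\<lambda>u. (?y u)\<^sup>2)"
    using jacobi_y_continuous[OF assms(1,2), of n] m(2)
    by (intro continuous_intros) (auto elim: continuous_on_subset)
  then obtain s where s: "s \<in> {0..m}" "\<And>v. v \<in> {0..m} \<Longrightarrow> (?y v)\<^sup>2 \<le> (?y s)\<^sup>2"
    using continuous_attains_sup[of "{0..m}" "\<lambda>u. (?y u)\<^sup>2"] m(1) by auto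
  have pos: "?y u > 0" if "0 < u" "u < m" for u
    using m(2) m(4)[of u] that by (simp add: jacobi_y_def weight_poly_def)
  have "(?y s)\<^sup>2 > 0"
    using s(2)[of "m / 2"] pos[of "m / 2"] m(1) by (smt (verit) atLeastAtMost_iff field_sum_of_halves zero_less_power)
  moreover have "?y 0 = 0" "?y m = 0" using m(3) by (simp_all add: jacobi_y_def) (simp add: weight_poly_def)
  ultimately have "s \<noteq> 0" "s \<noteq> m" by auto
  with s have s0: "0 < s" "s < m" by auto
  moreover have "poly (weight_diff (\<alpha> / 2) (\<beta> / 2) (jacobi_u n \<alpha> \<beta>)) s = 0"
  proof (rule weight_poly_critical[where a = 0 and b = m])
    show "weight_poly (\<alpha> / 2) (\<beta> / 2) (jacobi_u n \<alpha> \<beta>) s \<noteq> 0"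
      using pos[OF s0] by (simp add: jacobi_y_def)
  qed (use s0 m s in \<open>auto simp: jacobi_y_def\<close>)
  ultimately show ?thesis using that pos s by auto
qed

lemma jacobi_first_peak_bound:
  assumes "\<alpha> > 0" "\<beta> > 0" "n \<ge> 1" "0 \<le> v" "v \<le> Min (jacobi_roots n \<alpha> \<beta>)"
  shows "jacobi_norm n \<alpha> \<beta> * (jacobi_y n \<alpha> \<beta> v)\<^sup>2 < 1 / R_star \<alpha>"
proof -
  define p where "p = jacobi_u n \<alpha> \<beta>"
  define m where "m = Min (jacobi_roots n \<alpha> \<beta>)"
  let ?y = "jacobi_y n \<alpha> \<beta>"
  have ab: "\<alpha> > -1" "\<beta> > -1" using assms by auto
  note m = Min_jacobi_roots[OF ab assms(3), folded m_def, folded p_def]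
  obtain s where s: "0 < s" "s < m" "?y s > 0" "poly (weight_diff (\<alpha> / 2) (\<beta> / 2) p) s = 0"
    "\<And>v. 0 \<le> v \<Longrightarrow> v \<le> m \<Longrightarrow> (?y v)\<^sup>2 \<le> (?y s)\<^sup>2"
    by (rule jacobi_first_peak_exists[OF assms(1-3), folded m_def, folded p_def]) blast
  define \<phi> where "\<phi> u = (1 - u) powr (\<beta> / 2) * poly p u" for u
  have \<phi>s: "\<phi> s > 0" using m(4)[of s] s m(2) by (simp add: \<phi>_def)
  have ys: "(?y s)\<^sup>2 = s powr \<alpha> * (\<phi> s)\<^sup>2"
    using s(1) by (simp add: jacobi_y_def p_def weight_poly_def \<phi>_def power_mult_distrib powr_power)
  \<comment> \<open>The tangent of \<phi> at s is \<phi>(s)(h - k u): criticality of y =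
    u^(\<alpha>/2) \<phi> gives \<phi>'(s) = -k \<phi>(s), and h = 1 + k s. The tangent vanishes at
    b.\<close>
  define k where "k = \<alpha> / (2 * s)"
  define h where "h = 1 + \<alpha> / 2"
  define b where "b = h / k"
  have kh: "k > 0" "h > 0" "b > 0" using assms s by (auto simp: k_def h_def b_def)
  have tangent: "\<phi> u \<ge> \<phi> s * (h - k * u)" if "u \<in> {0..m}" for u
  proof -
    have "convex_on {0..m} \<phi>"
    proof -
      let ?Z = "jacobi_roots n \<alpha> \<beta>"
      have "convex_on {0..m} (\<lambda>u. (1 - u) powr (\<beta> / 2) * (\<Prod>z\<in>?Z. 1 - u / z))"
        unfolding m_def using ab assms jacobi_roots_nonempty[OF ab assms(3)]
        by (intro convex_on_powr_prod_linear finite_jacobi_roots) (auto simp: jacobi_roots_def)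
      then have "convex_on {0..m} (\<lambda>u. poly p 0 * ((1 - u) powr (\<beta> / 2) * (\<Prod>z\<in>?Z. 1 - u / z)))"
        using m(4)[of 0] m(1) by (intro convex_on_cmul) auto
      moreover have "poly p 0 * ((1 - u) powr (\<beta> / 2) * (\<Prod>z\<in>?Z. 1 - u / z)) = \<phi> u" for u
        unfolding \<phi>_def p_def using jacobi_u_factor[OF ab, of n u] by simp
      ultimately show ?thesis by simp
    qed
    moreover have "(\<phi> has_real_derivative - k * \<phi> s) (at s within {0..m})"
    proof -
      have s1: "s < 1" using s m by simp
      have "(\<phi> has_real_derivative - (\<beta> / 2 * (1 - s) powr (\<beta> / 2 - 1)) * poly p s
          + (1 - s) powr (\<beta> / 2) * poly (pderiv p) s) (at s)"
        unfolding \<phi>_def using s1 by (auto intro!: derivative_eq_intros)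
      moreover have "- (\<beta> / 2 * (1 - s) powr (\<beta> / 2 - 1)) * poly p s
          + (1 - s) powr (\<beta> / 2) * poly (pderiv p) s = - k * \<phi> s"
      proof -
        define w where "w = (1 - s) powr (\<beta> / 2 - 1)"
        have w: "(1 - s) powr (\<beta> / 2) = w * (1 - s)" using s1 by (simp add: w_def powr_diff)
        have "(\<alpha> / 2 - (\<alpha> / 2 + \<beta> / 2) * s) * poly p s + s * (1 - s) * poly (pderiv p) s = 0"
          using s(4) by (simp add: poly_weight_diff)
        moreover have "k * (2 * s) = \<alpha>" using s by (simp add: k_def)
        ultimately have "s * (- (\<beta> / 2 * w) * poly p s + w * (1 - s) * poly (pderiv p) s)
          = s * (- k * (w * (1 - s) * poly p s))" by algebra
        then have "- (\<beta> / 2 * w) * poly p s + w * (1 - s) * poly (pderiv p) s = - k * (w * (1 - s) * poly p s)"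
          using s(1) by (simp only: mult_cancel_left) simp
        then show ?thesis by (simp only: \<phi>_def w w_def[symmetric])
      qed
      ultimately show ?thesis by (metis has_field_derivative_at_within)
    qed
    ultimately have "\<phi> u - \<phi> s \<ge> - k * \<phi> s * (u - s)"
      using s m that by (intro convex_on_imp_above_tangent[where A = "{0..m}"]) (auto simp: interior_atLeastAtMost_real)
    moreover have "k * s = \<alpha> / 2" using s by (simp add: k_def)
    then have "\<phi> s * (h - k * u) = \<phi> s - k * \<phi> s * (u - s)" unfolding h_def by algebra
    ultimately show ?thesis by simp
  qed
  have "\<phi> m = 0" using m by (simp add: \<phi>_def)
  \<comment> \<open>At m the function \<phi> is zero and lies above its tangent, so the tangent has
    already reached zero there and [0, b] stays inside the interval of convexity.\<close>
  then have "h - k * m \<le> 0" using tangent[of m] m(1) \<phi>s by (auto simp: mult_le_0_iff)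
  then have bm: "b \<le> m" using kh by (simp add: b_def field_simps)
  define f where "f = weight_poly (\<alpha> - 1) \<beta> (p * p)"
  have f_eq: "f u = u powr (\<alpha> - 1) * (\<phi> u)\<^sup>2" for u
  proof -
    have "(1 - u) powr \<beta> = (1 - u) powr (\<beta> / 2) * (1 - u) powr (\<beta> / 2)" by (simp flip: powr_add)
    then show ?thesis by (simp add: f_def weight_poly_def \<phi>_def power2_eq_square)
  qed
  define I where "I = 1 / (\<alpha> * jacobi_norm n \<alpha> \<beta>)"
  have int: "(f has_integral I) {0..1}"
    unfolding f_def I_def p_def using assms by (intro jacobi_integral_left)
  have fb: "f integrable_on {0..b}" "f integrable_on {b..1}"
    using int bm m kh by (auto intro: integrable_subinterval_real has_integral_integrable)
  have "(\<phi> s)\<^sup>2 * (b powr \<alpha> * h\<^sup>2 * (2 / (\<alpha> * (\<alpha> + 1) * (\<alpha> + 2)))) \<le> integral {0..b} f"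
  proof (rule has_integral_le)
    show "((\<lambda>u. (\<phi> s)\<^sup>2 * (u powr (\<alpha> - 1) * (h - k * u)\<^sup>2)) has_integral
      (\<phi> s)\<^sup>2 * (b powr \<alpha> * h\<^sup>2 * (2 / (\<alpha> * (\<alpha> + 1) * (\<alpha> + 2))))) {0..b}"
      unfolding b_def using assms kh by (intro has_integral_mult_right has_integral_powr_times_square)
    show "(f has_integral integral {0..b} f) {0..b}" using fb by (simp add: integrable_integral)
    fix u assume u: "u \<in> {0..b}"
    \<comment> \<open>Up to b the tangent is nonnegative, so squaring preserves the comparison with
      \<phi>.\<close>
    then have "0 \<le> h - k * u" using kh by (simp add: b_def field_simps)
    then have "(\<phi> s * (h - k * u))\<^sup>2 \<le> (\<phi> u)\<^sup>2"
      using tangent[of u] u bm \<phi>s by (intro power_mono) auto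
    then have "u powr (\<alpha> - 1) * (\<phi> s * (h - k * u))\<^sup>2 \<le> u powr (\<alpha> - 1) * (\<phi> u)\<^sup>2"
      by (rule mult_left_mono) simp
    then show "(\<phi> s)\<^sup>2 * (u powr (\<alpha> - 1) * (h - k * u)\<^sup>2) \<le> f u"
      using u bm m(2) by (simp add: f_eq power_mult_distrib mult_ac)
  qed
  \<comment> \<open>The source of strictness: on [b, 1] the integrand is continuous and nonnegative,
    and inside it is nonzero away from finitely many roots.\<close>
  moreover have "integral {b..1} f > 0"
  proof -
    have nonneg: "f u \<ge> 0" for u by (simp add: f_def weight_poly_def)
    then have "integral {b..1} f \<ge> 0" using fb by (intro integral_nonneg) auto
    moreover have "integral {b..1} f \<noteq> 0"
    proof
      assume "integral {b..1} f = 0"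
      then have z: "(f has_integral 0) (cbox b 1)" using fb by (metis integrable_integral interval_cbox)
      have "infinite {b<..<1}" using bm m by (intro infinite_Ioo) auto
      then have "infinite ({b<..<1} - jacobi_roots n \<alpha> \<beta>)"
        using finite_jacobi_roots[OF ab(1)] by (intro Diff_infinite_finite)
      then obtain w where w: "b < w" "w < 1" "w \<notin> jacobi_roots n \<alpha> \<beta>"
        by (metis DiffE all_not_in_conv finite.emptyI greaterThanLessThan_iff)
      have "continuous_on (cbox b 1) f"
        unfolding f_def weight_poly_def[abs_def] cbox_interval using assms kh
        by (intro continuous_intros continuous_on_powr') auto
      then have "f w = 0"
        using has_integral_0_cbox_imp_0[OF _ _ z, of w] nonneg w by auto
      then show False using w kh by (auto simp: f_def weight_poly_def p_def jacobi_roots_def)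
    qed
    ultimately show ?thesis by simp
  qed
  moreover have "integral {0..b} f + integral {b..1} f = I"
    using int bm m kh Henstock_Kurzweil_Integration.integral_combine[of 0 b 1 f] has_integral_integrable[OF int]
    by (auto simp: integral_unique)
  ultimately have "(\<phi> s)\<^sup>2 * (b powr \<alpha> * h\<^sup>2 * (2 / (\<alpha> * (\<alpha> + 1) * (\<alpha> + 2)))) < I" by linarith
  also have "(\<phi> s)\<^sup>2 * (b powr \<alpha> * h\<^sup>2 * (2 / (\<alpha> * (\<alpha> + 1) * (\<alpha> + 2)))) = (?y s)\<^sup>2 * R_star \<alpha> / \<alpha>"
  proof -
    have "b = s * ((\<alpha> + 2) / \<alpha>)" using assms s by (simp add: b_def h_def k_def field_simps)
    then have B: "b powr \<alpha> = s powr \<alpha> * ((\<alpha> + 2) / \<alpha>) powr \<alpha>" by (simp only: powr_mult)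
    have H: "h\<^sup>2 * (2 / (\<alpha> * (\<alpha> + 1) * (\<alpha> + 2))) = (\<alpha> + 2) / (2 * (\<alpha> + 1)) / \<alpha>"
    proof -
      have "h\<^sup>2 = (\<alpha> + 2)\<^sup>2 / 4" by (simp add: h_def power2_eq_square field_simps)
      then show ?thesis using assms by (simp add: divide_simps) (simp add: power2_eq_square algebra_simps)
    qed
    have R: "R_star \<alpha> = (\<alpha> + 2) / (2 * (\<alpha> + 1)) * ((\<alpha> + 2) / \<alpha>) powr \<alpha>"
      using assms by (simp add: R_star_def)
    have "(\<phi> s)\<^sup>2 * (b powr \<alpha> * h\<^sup>2 * (2 / (\<alpha> * (\<alpha> + 1) * (\<alpha> + 2))))
      = (\<phi> s)\<^sup>2 * (b powr \<alpha> * (h\<^sup>2 * (2 / (\<alpha> * (\<alpha> + 1) * (\<alpha> + 2)))))"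
      by (simp only: mult.assoc)
    then show ?thesis unfolding H B R ys by (simp add: mult_ac)
  qed
  finally have "(?y s)\<^sup>2 * R_star \<alpha> / \<alpha> < I" .
  then have "jacobi_norm n \<alpha> \<beta> * (?y s)\<^sup>2 < 1 / R_star \<alpha>"
    using assms R_star_pos[of \<alpha>] jacobi_norm_pos[of \<alpha> \<beta> n] by (simp add: I_def field_simps)
  moreover have "jacobi_norm n \<alpha> \<beta> * (?y v)\<^sup>2 \<le> jacobi_norm n \<alpha> \<beta> * (?y s)\<^sup>2"
    using s(5)[of v] assms jacobi_norm_pos[of \<alpha> \<beta> n] by (intro mult_left_mono) (auto simp: m_def)
  ultimately show ?thesis by simp
qed

subsection \<open>The outer peaks dominate\<close>

text \<open>The potential S in (u (1 - u) d/du)^2 y = -S y, the form the Jacobi equation takes for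
  the weighted function y.\<close>

definition sonin :: "nat \<Rightarrow> real \<Rightarrow> real \<Rightarrow> real \<Rightarrow> real" where
  "sonin n \<alpha> \<beta> u = (real n * (real n + \<alpha> + \<beta> + 1) + (\<alpha> + \<beta>) / 2) * (u * (1 - u))
     - ((\<alpha> * (1 - u) - \<beta> * u) / 2)\<^sup>2"

definition sonin_deriv :: "nat \<Rightarrow> real \<Rightarrow> real \<Rightarrow> real \<Rightarrow> real" where
  "sonin_deriv n \<alpha> \<beta> u = (real n * (real n + \<alpha> + \<beta> + 1) + (\<alpha> + \<beta>) / 2) * (1 - 2 * u)
     + (\<alpha> + \<beta>) / 2 * (\<alpha> * (1 - u) - \<beta> * u)"

lemma sonin_has_deriv: "(sonin n \<alpha> \<beta> has_real_derivative sonin_deriv n \<alpha> \<beta> u) (at u)"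
proof -
  have "((\<lambda>u. c * (u * (1 - u)) - ((\<alpha> * (1 - u) - \<beta> * u) / 2)\<^sup>2) has_real_derivative
    c * (1 - 2 * u) + (\<alpha> + \<beta>) / 2 * (\<alpha> * (1 - u) - \<beta> * u)) (at u)" for c
    by (auto intro!: derivative_eq_intros simp: power2_eq_square field_simps)
  then show ?thesis by (simp add: sonin_def[abs_def] sonin_deriv_def)
qed

lemma sonin_deriv_reflect: "sonin_deriv n \<beta> \<alpha> (1 - u) = - sonin_deriv n \<alpha> \<beta> u"
  by (simp add: sonin_deriv_def field_simps)

text \<open>Strict concavity of S: once S' >= 0 at a point, S' > 0 everywhere to its left.\<close>

lemma sonin_deriv_strict_antimono:
  assumes "\<alpha> > 0" "\<beta> > 0" "u < v"
  shows "sonin_deriv n \<alpha> \<beta> v < sonin_deriv n \<alpha> \<beta> u"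
proof -
  have "sonin_deriv n \<alpha> \<beta> u - sonin_deriv n \<alpha> \<beta> v
    = (2 * (real n * (real n + \<alpha> + \<beta> + 1) + (\<alpha> + \<beta>) / 2) + (\<alpha> + \<beta>) / 2 * (\<alpha> + \<beta>)) * (v - u)"
    unfolding sonin_deriv_def by (simp add: field_simps)
  also have "\<dots> > 0"
    using assms by (intro mult_pos_pos add_pos_pos add_nonneg_pos) auto
  finally show ?thesis by simp
qed

lemma poly_pderiv_weight_diff:
  "poly (pderiv (weight_diff a b q)) u = - (a + b) * poly q u + (a - (a + b) * u) * poly (pderiv q) u
     + (1 - 2 * u) * poly (pderiv q) u + u * (1 - u) * poly (pderiv (pderiv q)) u"
  by (simp add: weight_diff_def pderiv_add pderiv_mult pderiv_pCons pderiv_smult pderiv_minus algebra_simps)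

text \<open>With half exponents, \<open>weight_diff\<close> represents u (1 - u) d/du acting on y.
  The differential equation removes p'', and the half exponents make the terms in p' cancel.\<close>

lemma jacobi_weight_diff_twice:
  assumes "\<alpha> > -1"
  shows "poly (weight_diff (\<alpha> / 2) (\<beta> / 2) (weight_diff (\<alpha> / 2) (\<beta> / 2) (jacobi_u n \<alpha> \<beta>))) u
    = - sonin n \<alpha> \<beta> u * poly (jacobi_u n \<alpha> \<beta>) u"
proof -
  define p0 p1 p2 where "p0 = poly (jacobi_u n \<alpha> \<beta>) u" and "p1 = poly (pderiv (jacobi_u n \<alpha> \<beta>)) u"
    and "p2 = poly (pderiv (pderiv (jacobi_u n \<alpha> \<beta>))) u"
  define c where "c = real n * (real n + \<alpha> + \<beta> + 1)"
  have H: "u * (1 - u) * p2 = - ((\<alpha> + 1 - (\<alpha> + \<beta> + 2) * u) * p1) - c * p0"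
    using arg_cong[OF jacobi_u_ode[OF assms, of n \<beta>], of "\<lambda>q. poly q u"]
    by (simp add: p0_def p1_def p2_def c_def) (simp add: algebra_simps)
  have "(\<alpha> / 2 - (\<alpha> / 2 + \<beta> / 2) * u) * ((\<alpha> / 2 - (\<alpha> / 2 + \<beta> / 2) * u) * p0 + u * (1 - u) * p1)
    + u * (1 - u) * (- (\<alpha> / 2 + \<beta> / 2) * p0 + (\<alpha> / 2 - (\<alpha> / 2 + \<beta> / 2) * u) * p1 + (1 - 2 * u) * p1 + u * (1 - u) * p2)
    = - ((c + (\<alpha> + \<beta>) / 2) * (u * (1 - u)) - ((\<alpha> * (1 - u) - \<beta> * u) / 2)\<^sup>2) * p0"
    unfolding H by (simp add: power2_eq_square field_simps)
  then show ?thesis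
    unfolding poly_weight_diff poly_pderiv_weight_diff sonin_def p0_def p1_def p2_def c_def .
qed

text \<open>With \<open>v = u(1 - u) y'\<close>, the function \<open>v\<^sup>2 + S y\<^sup>2\<close> has derivative \<open>S' y\<^sup>2\<close>, where \<open>S\<close> is
  the concave quadratic \<open>sonin\<close>.\<close>
definition sonin_energy :: "nat \<Rightarrow> real \<Rightarrow> real \<Rightarrow> real \<Rightarrow> real" where
  "sonin_energy n \<alpha> \<beta> u = (weight_poly (\<alpha> / 2) (\<beta> / 2) (weight_diff (\<alpha> / 2) (\<beta> / 2) (jacobi_u n \<alpha> \<beta>)) u)\<^sup>2
     + sonin n \<alpha> \<beta> u * (jacobi_y n \<alpha> \<beta> u)\<^sup>2"

text \<open>Since v = u (1 - u) y' and u (1 - u) v' = -S y, the terms 2 v v' and 2 S y y'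
  cancel.\<close>

lemma sonin_energy_has_deriv:
  assumes "\<alpha> > -1" "0 < u" "u < 1"
  shows "(sonin_energy n \<alpha> \<beta> has_real_derivative sonin_deriv n \<alpha> \<beta> u * (jacobi_y n \<alpha> \<beta> u)\<^sup>2) (at u)"
proof -
  let ?r = "weight_diff (\<alpha> / 2) (\<beta> / 2) (jacobi_u n \<alpha> \<beta>)"
  let ?v = "weight_poly (\<alpha> / 2) (\<beta> / 2) ?r"
  define w where "w = u powr (\<alpha> / 2 - 1) * (1 - u) powr (\<beta> / 2 - 1)"
  define p where "p = poly (jacobi_u n \<alpha> \<beta>) u"
  define r where "r = poly ?r u"
  have W: "u powr (\<alpha> / 2) * (1 - u) powr (\<beta> / 2) = w * (u * (1 - u))"
    using assms by (simp add: w_def powr_diff)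
  have y: "(jacobi_y n \<alpha> \<beta> has_real_derivative w * r) (at u)"
    using weight_poly_deriv[OF assms(2,3), of "\<alpha> / 2" "\<beta> / 2" "jacobi_u n \<alpha> \<beta>"]
    by (simp add: jacobi_y_def weight_poly_def w_def r_def)
  have v: "(?v has_real_derivative w * (- sonin n \<alpha> \<beta> u * p)) (at u)"
    using weight_poly_deriv[OF assms(2,3), of "\<alpha> / 2" "\<beta> / 2" ?r] jacobi_weight_diff_twice[OF assms(1), of \<beta> n u]
    by (simp add: weight_poly_def w_def p_def)
  have yv: "jacobi_y n \<alpha> \<beta> u = w * (u * (1 - u)) * p" "?v u = w * (u * (1 - u)) * r"
    by (simp_all add: jacobi_y_def weight_poly_def W p_def r_def)
  have "((\<lambda>u. (?v u)\<^sup>2 + sonin n \<alpha> \<beta> u * (jacobi_y n \<alpha> \<beta> u)\<^sup>2) has_real_derivative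
    2 * ?v u * (w * (- sonin n \<alpha> \<beta> u * p)) + (sonin_deriv n \<alpha> \<beta> u * (jacobi_y n \<alpha> \<beta> u)\<^sup>2
      + sonin n \<alpha> \<beta> u * (2 * jacobi_y n \<alpha> \<beta> u * (w * r)))) (at u)"
    using y v sonin_has_deriv[of n \<alpha> \<beta> u] by (auto intro!: derivative_eq_intros)
  moreover have "2 * ?v u * (w * (- sonin n \<alpha> \<beta> u * p)) + (sonin_deriv n \<alpha> \<beta> u * (jacobi_y n \<alpha> \<beta> u)\<^sup>2
      + sonin n \<alpha> \<beta> u * (2 * jacobi_y n \<alpha> \<beta> u * (w * r))) = sonin_deriv n \<alpha> \<beta> u * (jacobi_y n \<alpha> \<beta> u)\<^sup>2"
    unfolding yv by (simp add: power2_eq_square algebra_simps)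
  ultimately show ?thesis unfolding sonin_energy_def[abs_def] by (rule DERIV_cong)
qed

lemma sonin_energy_continuous:
  assumes "\<alpha> > 0" "\<beta> > 0"
  shows "continuous_on {0..1} (sonin_energy n \<alpha> \<beta>)"
proof -
  have "continuous_on {0..1} (sonin n \<alpha> \<beta>)" unfolding sonin_def by (intro continuous_intros) auto
  then show ?thesis unfolding sonin_energy_def using assms
    by (intro continuous_intros weight_poly_continuous jacobi_y_continuous) auto
qed

text \<open>Let s be the first peak and suppose s < u. Up to u the derivative S' is nonnegative, so
  the energy minus S y(u)^2 is nonincreasing on [s, u], its derivative being S' (y^2 - y(u)^2). It
  vanishes at u and equals S(s)(y(s)^2 - y(u)^2) at s. Positivity of S(s) then makes the first peak
  at least as high.\<close>

lemma global_peak_le_first_peak: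
  assumes "\<alpha> > 0" "\<beta> > 0" "n \<ge> 1" "0 < u" "u < 1" "jacobi_y n \<alpha> \<beta> u \<noteq> 0"
    and max: "\<And>v. v \<in> {0..1} \<Longrightarrow> (jacobi_y n \<alpha> \<beta> v)\<^sup>2 \<le> (jacobi_y n \<alpha> \<beta> u)\<^sup>2"
    and "sonin_deriv n \<alpha> \<beta> u \<ge> 0"
  shows "\<exists>v\<in>{0..Min (jacobi_roots n \<alpha> \<beta>)}. (jacobi_y n \<alpha> \<beta> u)\<^sup>2 \<le> (jacobi_y n \<alpha> \<beta> v)\<^sup>2"
proof (cases "u \<le> Min (jacobi_roots n \<alpha> \<beta>)")
  case True
  then show ?thesis using assms by auto
next
  case False
  define m where "m = Min (jacobi_roots n \<alpha> \<beta>)"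
  let ?y = "jacobi_y n \<alpha> \<beta>"
  obtain s where s: "0 < s" "s < m" "?y s > 0"
    "poly (weight_diff (\<alpha> / 2) (\<beta> / 2) (jacobi_u n \<alpha> \<beta>)) s = 0"
    by (rule jacobi_first_peak_exists[OF assms(1-3), folded m_def]) blast
  have su: "s < u" using s False by (simp add: m_def)
  have crit: "poly (weight_diff (\<alpha> / 2) (\<beta> / 2) (jacobi_u n \<alpha> \<beta>)) u = 0"
    using assms(4-6) max by (intro weight_poly_critical[where a = 0 and b = 1]) (auto simp: jacobi_y_def)
  have dpos: "sonin_deriv n \<alpha> \<beta> v > 0" if "v < u" for v
    using sonin_deriv_strict_antimono[OF assms(1,2) that, of n] assms(8) by simp
  have cont: "continuous_on {a..b} (sonin_energy n \<alpha> \<beta>)" if "0 \<le> a" "b \<le> 1" for a b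
    using that by (intro continuous_on_subset[OF sonin_energy_continuous[OF assms(1,2)]]) auto
  have "sonin_energy n \<alpha> \<beta> 0 < sonin_energy n \<alpha> \<beta> s"
  proof (rule DERIV_pos_imp_increasing_open[OF s(1)])
    show "continuous_on {0..s} (sonin_energy n \<alpha> \<beta>)" using cont su assms by simp
    fix v assume v: "0 < v" "v < s"
    have "poly (jacobi_u n \<alpha> \<beta>) v > 0"
      using v s assms by (intro Min_jacobi_roots(4)) (auto simp: m_def)
    then have "sonin_deriv n \<alpha> \<beta> v * (?y v)\<^sup>2 > 0"
      using dpos[of v] v su assms by (simp add: jacobi_y_def weight_poly_def)
    then show "\<exists>y. (sonin_energy n \<alpha> \<beta> has_real_derivative y) (at v) \<and> 0 < y"
      using sonin_energy_has_deriv[of \<alpha> v n \<beta>] v su assms by auto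
  qed
  \<comment> \<open>The energy is 0 at the endpoint 0, and at the critical point s it reduces to
    S(s) y(s)^2.\<close>
  then have "sonin n \<alpha> \<beta> s * (?y s)\<^sup>2 > 0"
    using s(4) by (simp add: sonin_energy_def jacobi_y_def) (simp add: weight_poly_def)
  then have Spos: "sonin n \<alpha> \<beta> s > 0" using s(3) by (simp add: zero_less_mult_iff)
  define D where "D v = sonin_energy n \<alpha> \<beta> v - (?y u)\<^sup>2 * sonin n \<alpha> \<beta> v" for v
  have "D u \<le> D s"
  proof (rule DERIV_nonpos_imp_nonincreasing[where f = D])
    show "s \<le> u" using su by simp
    fix v assume v: "s \<le> v" "v \<le> u"
    have "(D has_real_derivative sonin_deriv n \<alpha> \<beta> v * (?y v)\<^sup>2 - (?y u)\<^sup>2 * sonin_deriv n \<alpha> \<beta> v) (at v)"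
      unfolding D_def using v s assms
      by (intro DERIV_diff DERIV_cmult sonin_energy_has_deriv sonin_has_deriv) auto
    moreover have "sonin_deriv n \<alpha> \<beta> v \<ge> 0" using dpos[of v] v assms(8) by (cases "v = u") auto
    then have "sonin_deriv n \<alpha> \<beta> v * (?y v)\<^sup>2 \<le> sonin_deriv n \<alpha> \<beta> v * (?y u)\<^sup>2"
      using v s assms(4,5) by (intro mult_left_mono max) auto
    ultimately show "\<exists>y. (D has_real_derivative y) (at v) \<and> y \<le> 0"
      by (metis diff_le_0_iff_le mult.commute)
  qed
  moreover have "D u = 0" using crit by (simp add: D_def sonin_energy_def weight_poly_def)
  moreover have "D s = sonin n \<alpha> \<beta> s * ((?y s)\<^sup>2 - (?y u)\<^sup>2)"
    using s(4) by (simp add: D_def sonin_energy_def weight_poly_def right_diff_distrib)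
  ultimately have "(?y u)\<^sup>2 \<le> (?y s)\<^sup>2" using Spos by (simp add: zero_le_mult_iff)
  then show ?thesis using s by (auto simp: m_def)
qed

text \<open>The sign of S' at a global maximum selects the end of the interval: if it is negative,
  reflection swaps the parameters and reverses the sign.\<close>

lemma jacobi_y_global_max:
  assumes "\<alpha> > 0" "\<beta> > 0" "n \<ge> 1" "u \<in> {0..1}"
  shows "(\<exists>v\<in>{0..Min (jacobi_roots n \<alpha> \<beta>)}. (jacobi_y n \<alpha> \<beta> u)\<^sup>2 \<le> (jacobi_y n \<alpha> \<beta> v)\<^sup>2)
    \<or> (\<exists>v\<in>{0..Min (jacobi_roots n \<beta> \<alpha>)}. (jacobi_y n \<alpha> \<beta> u)\<^sup>2 \<le> (jacobi_y n \<beta> \<alpha> v)\<^sup>2)"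
proof -
  let ?y = "jacobi_y n \<alpha> \<beta>"
  have "continuous_on {0..1} (\<lambda>u. (?y u)\<^sup>2)"
    using jacobi_y_continuous[OF assms(1,2), of n] by (intro continuous_intros)
  then obtain t where t: "t \<in> {0..1}" "\<And>v. v \<in> {0..1} \<Longrightarrow> (?y v)\<^sup>2 \<le> (?y t)\<^sup>2"
    using continuous_attains_sup[of "{0..1}" "\<lambda>u. (?y u)\<^sup>2"] by auto
  have m: "0 < Min (jacobi_roots n \<alpha> \<beta>)" using assms by (intro Min_jacobi_roots) auto
  show ?thesis
  proof (cases "?y t = 0")
    case True
    then have "(?y u)\<^sup>2 \<le> (?y 0)\<^sup>2" using t(2)[OF assms(4)] by simp
    then show ?thesis using m by (intro disjI1 bexI[of _ 0]) auto
  next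
    case False
    then have "t \<noteq> 0" "t \<noteq> 1" by (auto simp: jacobi_y_def)
    with t have t01: "0 < t" "t < 1" by auto
    have refl: "(jacobi_y n \<beta> \<alpha> (1 - v))\<^sup>2 = (?y v)\<^sup>2" for v
    proof -
      have "jacobi_y n \<beta> \<alpha> (1 - v) = ?y v \<or> jacobi_y n \<beta> \<alpha> (1 - v) = - ?y v"
        using jacobi_y_reflect[OF assms(2,1), of n v] by (cases "even n") auto
      then show ?thesis by auto
    qed
    show ?thesis
    proof (cases "sonin_deriv n \<alpha> \<beta> t \<ge> 0")
      case True
      from global_peak_le_first_peak[OF assms(1-3) t01 False t(2) True]
      obtain v where "v \<in> {0..Min (jacobi_roots n \<alpha> \<beta>)}" "(?y t)\<^sup>2 \<le> (?y v)\<^sup>2" by auto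
      then show ?thesis using t(2)[OF assms(4)] by (intro disjI1 bexI[of _ v]) auto
    next
      case neg: False
      have "\<exists>v\<in>{0..Min (jacobi_roots n \<beta> \<alpha>)}. (jacobi_y n \<beta> \<alpha> (1 - t))\<^sup>2 \<le> (jacobi_y n \<beta> \<alpha> v)\<^sup>2"
      proof (rule global_peak_le_first_peak[OF assms(2,1,3)])
        show "jacobi_y n \<beta> \<alpha> (1 - t) \<noteq> 0" using refl[of t] False by auto
        show "(jacobi_y n \<beta> \<alpha> v)\<^sup>2 \<le> (jacobi_y n \<beta> \<alpha> (1 - t))\<^sup>2" if "v \<in> {0..1}" for v
          using refl[of "1 - v"] refl[of t] t(2)[of "1 - v"] that by auto
        show "sonin_deriv n \<beta> \<alpha> (1 - t) \<ge> 0" using neg by (simp add: sonin_deriv_reflect)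
      qed (use t01 in auto)
      then obtain v where "v \<in> {0..Min (jacobi_roots n \<beta> \<alpha>)}" "(?y t)\<^sup>2 \<le> (jacobi_y n \<beta> \<alpha> v)\<^sup>2"
        unfolding refl by auto
      then show ?thesis using t(2)[OF assms(4)] by (intro disjI2 bexI[of _ v]) auto
    qed
  qed
qed

subsection \<open>An Agmon estimate\<close>

text \<open>The integrand is \<open>u (1 - u) y'\<^sup>2\<close>.\<close>
lemma jacobi_dirichlet_integral:
  fixes n :: nat
  assumes "\<alpha> > 0" "\<beta> > 0"
  defines "p \<equiv> jacobi_u n \<alpha> \<beta>"
  defines "r \<equiv> weight_diff (\<alpha> / 2) (\<beta> / 2) p"
  obtains E where "E \<le> (2 * real n + 1) / (4 * jacobi_norm n \<alpha> \<beta>)"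
    "(weight_poly (\<alpha> - 1) (\<beta> - 1) (r * r) has_integral E) {0..1}"
proof -
  define s where "s = \<alpha> + \<beta>"
  \<comment> \<open>Chosen so that S = L u (1 - u) - \<alpha>^2 (1 - u)/4 - \<beta>^2 u/4; after
    division by u (1 - u), S y^2 combines the three known integrands.\<close>
  define L where "L = real n * (real n + \<alpha> + \<beta> + 1) + s / 2 + s\<^sup>2 / 4"
  define c where "c = jacobi_norm n \<alpha> \<beta>"
  have c: "c > 0" using assms jacobi_norm_pos by (simp add: c_def)
  \<comment> \<open>With v = u (1 - u) y', this integrates (y v)' = (v^2 - S y^2)/(u (1 - u)); the
    leading 0 is the integral of the total derivative.\<close>
  define E where "E = 0 + L * (1 / ((2 * real n + \<alpha> + \<beta> + 1) * c)) - \<alpha>\<^sup>2 / 4 * (1 / (\<alpha> * c)) - \<beta>\<^sup>2 / 4 * (1 / (\<beta> * c))"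
  have "((\<lambda>u. weight_poly (\<alpha> - 1) (\<beta> - 1) (weight_diff \<alpha> \<beta> (r * p)) u + L * weight_poly \<alpha> \<beta> (p * p) u
    - \<alpha>\<^sup>2 / 4 * weight_poly (\<alpha> - 1) \<beta> (p * p) u - \<beta>\<^sup>2 / 4 * weight_poly \<alpha> (\<beta> - 1) (p * p) u) has_integral E) {0..1}"
    unfolding E_def c_def p_def using assms
    by (intro has_integral_diff has_integral_add has_integral_mult_right weight_poly_ibp
        jacobi_integral_left jacobi_integral_mid jacobi_integral_right)
  moreover have "weight_poly (\<alpha> - 1) (\<beta> - 1) (weight_diff \<alpha> \<beta> (r * p)) u + L * weight_poly \<alpha> \<beta> (p * p) u
    - \<alpha>\<^sup>2 / 4 * weight_poly (\<alpha> - 1) \<beta> (p * p) u - \<beta>\<^sup>2 / 4 * weight_poly \<alpha> (\<beta> - 1) (p * p) u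
    = weight_poly (\<alpha> - 1) (\<beta> - 1) (r * r) u" if "u \<in> {0..1}" for u
  proof (cases "u = 0 \<or> u = 1")
    case False
    with that have u: "0 < u" "u < 1" by auto
    define w where "w = u powr (\<alpha> - 1) * (1 - u) powr (\<beta> - 1)"
    define p0 p1 r0 r1 where "p0 = poly p u" and "p1 = poly (pderiv p) u"
      and "r0 = poly r u" and "r1 = poly (pderiv r) u"
    have W: "u powr \<alpha> * (1 - u) powr \<beta> = w * (u * (1 - u))" "u powr (\<alpha> - 1) * (1 - u) powr \<beta> = w * (1 - u)"
      "u powr \<alpha> * (1 - u) powr (\<beta> - 1) = w * u"
      using u by (simp_all add: w_def powr_diff)
    define d where "d = \<alpha> / 2 - (\<alpha> / 2 + \<beta> / 2) * u"
    have p1: "u * (1 - u) * p1 = r0 - d * p0"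
      by (simp add: r0_def r_def poly_weight_diff p0_def p1_def d_def)
    have S: "sonin n \<alpha> \<beta> u = L * (u * (1 - u)) - \<alpha>\<^sup>2 / 4 * (1 - u) - \<beta>\<^sup>2 / 4 * u"
      by (simp add: sonin_def L_def s_def power2_eq_square field_simps)
    have "d * r0 + u * (1 - u) * r1 = - sonin n \<alpha> \<beta> u * p0"
      using jacobi_weight_diff_twice[of \<alpha> \<beta> n u] assms(1)
      unfolding p_def[symmetric] r_def[symmetric] p0_def r0_def r1_def d_def by (simp add: poly_weight_diff)
    then have r1: "u * (1 - u) * r1 = - sonin n \<alpha> \<beta> u * p0 - d * r0" by simp
    have "u * (1 - u) * (r1 * p0 + r0 * p1) = (u * (1 - u) * r1) * p0 + r0 * (u * (1 - u) * p1)"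
      by (simp add: algebra_simps)
    also have "\<dots> = r0 * r0 - 2 * d * (r0 * p0) - sonin n \<alpha> \<beta> u * (p0 * p0)"
      unfolding p1 r1 by (simp add: algebra_simps)
    finally have F: "(\<alpha> - (\<alpha> + \<beta>) * u) * (r0 * p0) + u * (1 - u) * (r1 * p0 + r0 * p1)
      = r0 * r0 - sonin n \<alpha> \<beta> u * (p0 * p0)"
      by (simp add: d_def field_simps)
    have "w * ((\<alpha> - (\<alpha> + \<beta>) * u) * (r0 * p0) + u * (1 - u) * (r1 * p0 + r0 * p1))
      + L * (w * (u * (1 - u)) * (p0 * p0)) - \<alpha>\<^sup>2 / 4 * (w * (1 - u) * (p0 * p0)) - \<beta>\<^sup>2 / 4 * (w * u * (p0 * p0)) = w * (r0 * r0)"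
      unfolding F S by (simp add: field_simps)
    moreover have "poly (weight_diff \<alpha> \<beta> (r * p)) u
      = (\<alpha> - (\<alpha> + \<beta>) * u) * (r0 * p0) + u * (1 - u) * (r1 * p0 + r0 * p1)"
      unfolding poly_weight_diff pderiv_mult poly_add poly_mult p0_def p1_def r0_def r1_def by (simp only: add.commute mult.commute)
    ultimately show ?thesis
      unfolding weight_poly_def W poly_mult w_def[symmetric] p0_def[symmetric] r0_def[symmetric] by simp
  qed auto
  ultimately have int: "(weight_poly (\<alpha> - 1) (\<beta> - 1) (r * r) has_integral E) {0..1}"
    by (rule has_integral_eq[rotated])
  \<comment> \<open>The right-hand side exceeds L by exactly 1/4.\<close>
  have "L \<le> (2 * real n + s + 1) * ((2 * real n + s + 1) / 4)"
    by (simp add: L_def s_def power2_eq_square field_simps)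
  then have "L / (2 * real n + s + 1) \<le> (2 * real n + s + 1) / 4"
    using assms by (simp add: pos_divide_le_eq s_def mult.commute)
  moreover have "E = (L / (2 * real n + s + 1) - s / 4) / c"
    using assms c by (simp add: E_def s_def power2_eq_square diff_divide_distrib add_divide_distrib add.assoc)
  moreover have "(2 * real n + s + 1) / 4 - s / 4 = (2 * real n + 1) / 4" by (simp add: field_simps)
  ultimately have "E \<le> (2 * real n + 1) / 4 / c"
    using divide_right_mono[of "L / (2 * real n + s + 1) - s / 4" "(2 * real n + 1) / 4" c] c by linarith
  with int that show thesis by (simp add: c_def)
qed

text \<open>An Agmon-type estimate: \<open>2 y\<^sup>2 \<le> \<integral> |(y\<^sup>2)'| \<le> \<epsilon> \<integral> y\<^sup>2 / (u (1 - u)) + \<epsilon>\<inverse> \<integral> u (1 - u) y'\<^sup>2\<close>.\<close>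
lemma jacobi_agmon_bound:
  assumes "\<alpha> > 0" "\<beta> > 0" "v \<in> {0..1}"
  shows "(jacobi_norm n \<alpha> \<beta> * (jacobi_y n \<alpha> \<beta> v)\<^sup>2)\<^sup>2 \<le> (2 * real n + 1) * (\<alpha> + \<beta>) / (4 * \<alpha> * \<beta>)"
proof -
  define p where "p = jacobi_u n \<alpha> \<beta>"
  define r where "r = weight_diff (\<alpha> / 2) (\<beta> / 2) p"
  define c where "c = jacobi_norm n \<alpha> \<beta>"
  have c: "c > 0" using assms jacobi_norm_pos by (simp add: c_def)
  define Y where "Y = weight_poly \<alpha> \<beta> (p * p)"
  define Y' where "Y' = weight_poly (\<alpha> - 1) (\<beta> - 1) (weight_diff \<alpha> \<beta> (p * p))"
  have Y: "Y u = (jacobi_y n \<alpha> \<beta> u)\<^sup>2" for u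
  proof -
    have h: "x powr a = x powr (a / 2) * x powr (a / 2)" for x a :: real by (simp flip: powr_add)
    show ?thesis unfolding Y_def jacobi_y_def weight_poly_def p_def h[of _ \<alpha>] h[of _ \<beta>]
      by (simp add: power2_eq_square)
  qed
  define K where "K = 1 / \<alpha> + 1 / \<beta>"
  define B where "B = (2 * real n + 1) / 4"
  \<comment> \<open>The minimiser of e K + B/e, with value 2 sqrt (B K). Here K is c times the
    integral of y^2/(u (1 - u)), and B is c times the bound for the integral of u (1 - u)
    y'^2.\<close>
  define e where "e = sqrt (B / K)"
  have "K > 0" "B > 0" using assms by (simp_all add: K_def B_def add_pos_pos)
  then have pos: "K > 0" "B > 0" "e > 0" by (simp_all add: e_def)
  obtain E where E: "E \<le> (2 * real n + 1) / (4 * c)" "(weight_poly (\<alpha> - 1) (\<beta> - 1) (r * r) has_integral E) {0..1}"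
    unfolding c_def r_def p_def by (rule jacobi_dirichlet_integral[OF assms(1,2), of n]) blast
  define A where "A = (\<lambda>u. e * (weight_poly (\<alpha> - 1) \<beta> (p * p) u + weight_poly \<alpha> (\<beta> - 1) (p * p) u)
      + weight_poly (\<alpha> - 1) (\<beta> - 1) (r * r) u / e)"
  define I where "I = e * (1 / (\<alpha> * c) + 1 / (\<beta> * c)) + E / e"
  have intA: "(A has_integral I) {0..1}"
    unfolding A_def I_def c_def p_def using assms E(2)
    by (intro has_integral_add has_integral_mult_right has_integral_divide jacobi_integral_left jacobi_integral_right)
      (simp_all add: p_def)
  have Y'A: "\<bar>Y' u\<bar> \<le> A u" if "u \<in> {0..1}" for u
  proof (cases "u = 0 \<or> u = 1")
    case True
    then show ?thesis by (auto simp: Y'_def A_def)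
  next
    case False
    with that have u: "0 < u" "u < 1" by auto
    define w where "w = u powr (\<alpha> - 1) * (1 - u) powr (\<beta> - 1)"
    have w: "w \<ge> 0" by (simp add: w_def)
    define p0 r0 where "p0 = poly p u" and "r0 = poly r u"
    have W: "u powr (\<alpha> - 1) * (1 - u) powr \<beta> = w * (1 - u)" "u powr \<alpha> * (1 - u) powr (\<beta> - 1) = w * u"
      using u by (simp_all add: w_def powr_diff)
    have "poly (weight_diff \<alpha> \<beta> (p * p)) u = 2 * p0 * r0"
      by (simp add: poly_weight_diff r0_def r_def p0_def pderiv_mult field_simps)
    then have Yu: "Y' u = w * (2 * p0 * r0)" by (simp add: Y'_def weight_poly_def w_def)
    have Au: "A u = w * (e * p0\<^sup>2 + r0\<^sup>2 / e)"
      unfolding A_def weight_poly_def W w_def[symmetric] by (simp add: p0_def r0_def power2_eq_square algebra_simps)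
    have "\<bar>2 * p0 * r0\<bar> \<le> e * p0\<^sup>2 + r0\<^sup>2 / e"
    proof -
      have "2 * (sqrt e * \<bar>p0\<bar>) * (\<bar>r0\<bar> / sqrt e) \<le> (sqrt e * \<bar>p0\<bar>)\<^sup>2 + (\<bar>r0\<bar> / sqrt e)\<^sup>2"
        by (rule sum_squares_bound)
      then show ?thesis using pos(3) by (simp add: power_mult_distrib power_divide abs_mult)
    qed
    then have "w * \<bar>2 * p0 * r0\<bar> \<le> w * (e * p0\<^sup>2 + r0\<^sup>2 / e)" using w by (rule mult_left_mono)
    moreover have "\<bar>Y' u\<bar> = w * \<bar>2 * p0 * r0\<bar>" unfolding Yu abs_mult[of w] using w by simp
    ultimately show ?thesis unfolding Au by simp
  qed
  have ftc: "(Y' has_integral Y b - Y a) {a..b}" if "0 \<le> a" "a \<le> b" "b \<le> 1" for a b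
  proof (rule fundamental_theorem_of_calculus_interior)
    show "continuous_on {a..b} Y"
      unfolding Y_def using that assms by (intro continuous_on_subset[OF weight_poly_continuous]) auto
    show "(Y has_vector_derivative Y' x) (at x)" if "x \<in> {a<..<b}" for x
      using weight_poly_deriv[of x \<alpha> \<beta> "p * p"] that \<open>0 \<le> a\<close> \<open>b \<le> 1\<close>
      by (simp add: has_real_derivative_iff_has_vector_derivative Y_def Y'_def)
  qed (use that in auto)
  have A_int: "A integrable_on {0..v}" "A integrable_on {v..1}"
    using intA assms(3) by (auto intro: integrable_subinterval_real has_integral_integrable)
  have "Y v - Y 0 \<le> integral {0..v} A"
  proof (rule has_integral_le)
    show "(Y' has_integral Y v - Y 0) {0..v}" using ftc assms(3) by simp
    show "(A has_integral integral {0..v} A) {0..v}" using A_int by (simp add: integrable_integral)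
    show "Y' u \<le> A u" if "u \<in> {0..v}" for u using Y'A[of u] that assms(3) by simp
  qed
  moreover have "- (Y 1 - Y v) \<le> integral {v..1} A"
  proof (rule has_integral_le)
    show "((\<lambda>u. - Y' u) has_integral - (Y 1 - Y v)) {v..1}" using ftc assms(3) by (intro has_integral_neg) simp
    show "(A has_integral integral {v..1} A) {v..1}" using A_int by (simp add: integrable_integral)
    show "- Y' u \<le> A u" if "u \<in> {v..1}" for u using Y'A[of u] that assms(3) by simp
  qed
  moreover have "integral {0..v} A + integral {v..1} A = I"
    using intA assms(3) Henstock_Kurzweil_Integration.integral_combine[of 0 v 1 A] has_integral_integrable[OF intA]
    by (auto simp: integral_unique)
  moreover have "Y 0 = 0" "Y 1 = 0" by (simp_all add: Y_def)
  \<comment> \<open>As Y vanishes at both ends, each of [0, v] and [v, 1] bounds \<open>Y v\<close>;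
    adding them gives the factor 2.\<close>
  ultimately have "2 * Y v \<le> I" by linarith
  also have "\<dots> \<le> e * (1 / (\<alpha> * c) + 1 / (\<beta> * c)) + (B / c) / e"
    unfolding I_def using E(1) pos by (intro add_left_mono divide_right_mono) (auto simp: B_def)
  also have "\<dots> = (e * K + B / e) / c"
    by (simp add: K_def add_divide_distrib distrib_left)
  also have "e * K + B / e = 2 * sqrt (B * K)"
  proof -
    have "e * e = B / K" using pos by (simp add: e_def)
    then have "B = e * e * K" using pos(1) by simp
    then have "B / e = e * K" using pos(3) by simp
    moreover have "sqrt (B * K) = e * K"
    proof (rule real_sqrt_unique)
      have "(e * K)\<^sup>2 = e * e * K * K" by (simp only: power2_eq_square mult_ac)
      then show "(e * K)\<^sup>2 = B * K" using \<open>B = e * e * K\<close> by simp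
    qed (use pos in simp)
    ultimately show ?thesis by simp
  qed
  finally have "c * Y v \<le> sqrt (B * K)" using c by (simp add: pos_le_divide_eq mult.commute)
  then have "(c * Y v)\<^sup>2 \<le> (sqrt (B * K))\<^sup>2"
    using c Y by (intro power_mono) auto
  also have "\<dots> = (2 * real n + 1) * (\<alpha> + \<beta>) / (4 * \<alpha> * \<beta>)"
  proof -
    have "K = (\<alpha> + \<beta>) / (\<alpha> * \<beta>)" using assms by (simp add: K_def field_simps)
    then have "B * K = (2 * real n + 1) * (\<alpha> + \<beta>) / (4 * \<alpha> * \<beta>)" by (simp add: B_def)
    moreover have "(sqrt (B * K))\<^sup>2 = B * K" using pos by (intro real_sqrt_pow2) simp
    ultimately show ?thesis by simp
  qed
  finally show ?thesis by (simp add: c_def Y)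
qed

subsection \<open>The bounds\<close>

text \<open>A simple bound that suffices for the comparison with \<open>T_bound\<close>. For a >= 1,
  Bernoulli's inequality gives \<open>R_star a\<close> >= 3/2. For a < 1, (a + 2)/a >= 3, and 9^a >=
  1 + 2a leaves a polynomial inequality.\<close>

lemma R_star_square_ge:
  assumes "a > 0"
  shows "min 2 (1 + a / 2) \<le> (R_star a)\<^sup>2"
proof (cases "a \<ge> 1")
  case True
  have "3 \<le> 1 + a * (2 / a)" using assms by simp
  also have "\<dots> \<le> (1 + 2 / a) powr a"
  proof -
    \<comment> \<open>Bernoulli's inequality, as the tangent at 1 to the convex function
      x^a.\<close>
    have "(1 + 2 / a) powr a - 1 powr a \<ge> a * (1 + 2 / a - 1)"
      using True powr_convex[OF True]
      by (intro convex_on_imp_above_tangent[where A = "{0<..}"])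
        (auto intro!: derivative_eq_intros simp: interior_open add_pos_pos)
    then show ?thesis by simp
  qed
  also have "1 + 2 / a = (a + 2) / a" using assms by (simp add: field_simps)
  finally have 3: "3 \<le> ((a + 2) / a) powr a" .
  have 2: "1 / 2 \<le> (a + 2) / (2 * (a + 1))" using assms by (simp add: field_simps)
  have "1 / 2 * 3 \<le> (a + 2) / (2 * (a + 1)) * ((a + 2) / a) powr a"
    using assms by (intro mult_mono[OF 2 3]) simp_all
  then have "1 / 2 * 3 \<le> R_star a" using assms by (simp add: R_star_def)
  then have "(1 / 2 * 3)\<^sup>2 \<le> (R_star a)\<^sup>2" by (rule power_mono) simp
  then show ?thesis by (simp add: power2_eq_square)
next
  case False
  have "1 + 2 * a \<le> 9 powr a"
  proof -
    have "(2::real) \<le> ln 9"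
    proof -
      have "exp (2::real) = exp 1 ^ 2" by (simp flip: exp_of_nat_mult)
      also have "\<dots> \<le> 3 ^ 2" using exp_le by (intro power_mono) auto
      finally show ?thesis by (simp add: ln_ge_iff)
    qed
    then have "1 + 2 * a \<le> 1 + a * ln 9" using assms by simp
    also have "\<dots> \<le> exp (a * ln 9)" by (rule exp_ge_add_one_self)
    finally show ?thesis by (simp add: powr_def)
  qed
  also have "9 powr a = (3 powr a)\<^sup>2"
    by (simp add: power2_eq_square flip: powr_mult)
  also have "\<dots> \<le> (((a + 2) / a) powr a)\<^sup>2"
    using assms False by (intro power_mono powr_mono2) (auto simp: field_simps)
  finally have *: "1 + 2 * a \<le> (((a + 2) / a) powr a)\<^sup>2" .
  have "1 + a / 2 \<le> ((a + 2) / (2 * (a + 1)))\<^sup>2 * (1 + 2 * a)"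
  proof -
    \<comment> \<open>The difference of the two sides is a^2 + 2a.\<close>
    have "(2 * (a + 1))\<^sup>2 * (1 + a / 2) \<le> (a + 2)\<^sup>2 * (1 + 2 * a)"
      using assms by (simp add: power2_eq_square algebra_simps)
    then show ?thesis using assms by (simp add: power_divide field_simps)
  qed
  also have "\<dots> \<le> ((a + 2) / (2 * (a + 1)))\<^sup>2 * (((a + 2) / a) powr a)\<^sup>2"
    using * by (intro mult_left_mono) auto
  also have "\<dots> = ((a + 2) / (2 * (a + 1)) * ((a + 2) / a) powr a)\<^sup>2" by (simp only: power_mult_distrib)
  also have "(a + 2) / (2 * (a + 1)) * ((a + 2) / a) powr a = R_star a" using assms by (simp add: R_star_def)
  finally show ?thesis by simp
qed

lemma R_star_gt_1:
  assumes "a > 0"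
  shows "R_star a > 1"
proof -
  have "1 < (R_star a)\<^sup>2" using R_star_square_ge[OF assms] assms by linarith
  then show ?thesis using R_star_pos[OF assms] by (smt (verit) one_power2 power_mono)
qed

lemma R_star_powr_less_1: "a > 0 \<Longrightarrow> R_star a powr (-1/2) < 1"
  using R_star_gt_1[of a] by (simp add: powr_minus_divide powr_less_one)

lemma abs_less_powr_minus_half:
  fixes x R :: real
  assumes "R > 0" "x\<^sup>2 < 1 / R"
  shows "\<bar>x\<bar> < R powr (-1/2)"
proof -
  have "\<bar>x\<bar> = sqrt (x\<^sup>2)" by simp
  also have "\<dots> < sqrt (1 / R)" using assms by (simp only: real_sqrt_less_iff)
  also have "\<dots> = R powr (-1/2)"
    using assms by (simp add: powr_minus powr_half_sqrt real_sqrt_divide inverse_eq_divide)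
  finally show ?thesis .
qed

section \<open>Return to the variable x and the nodal intervals\<close>

lemma jacobi_g_conv_y:
  assumes "\<alpha> > 0" "\<beta> > 0"
  shows "jacobi_g n \<alpha> \<beta> x = sqrt (jacobi_norm n \<alpha> \<beta>) * jacobi_y n \<alpha> \<beta> ((1 - x) / 2)"
proof -
  have e: "1 - (1 - x) / 2 = (1 + x) / 2" by (simp add: field_simps)
  show ?thesis using assms unfolding jacobi_y_def weight_poly_def e
    by (simp add: jacobi_g_def jacobi_norm_def rpow_def poly_jacobi_poly)
qed

lemma jacobi_g_square:
  assumes "\<alpha> > 0" "\<beta> > 0"
  shows "(jacobi_g n \<alpha> \<beta> x)\<^sup>2 = jacobi_norm n \<alpha> \<beta> * (jacobi_y n \<alpha> \<beta> ((1 - x) / 2))\<^sup>2"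
  using assms jacobi_norm_pos[OF assms, of n] by (simp add: jacobi_g_conv_y power_mult_distrib)

lemma jacobi_g_reflect:
  assumes "\<alpha> > 0" "\<beta> > 0"
  shows "\<bar>jacobi_g n \<alpha> \<beta> (- x)\<bar> = \<bar>jacobi_g n \<beta> \<alpha> x\<bar>"
proof -
  have e: "(1 - - x) / 2 = 1 - (1 - x) / 2" by (simp add: field_simps)
  have "jacobi_y n \<alpha> \<beta> ((1 - - x) / 2) = (-1) ^ n * jacobi_y n \<beta> \<alpha> ((1 - x) / 2)"
    unfolding e using assms by (rule jacobi_y_reflect)
  then show ?thesis unfolding jacobi_g_conv_y[OF assms] jacobi_g_conv_y[OF assms(2,1)]
    by (simp add: jacobi_norm_commute[of n \<alpha>] abs_mult power_abs)
qed

lemma continuous_on_rpow: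
  assumes "a \<ge> 0" "continuous_on S f" "\<And>x. x \<in> S \<Longrightarrow> f x \<ge> 0"
  shows "continuous_on S (\<lambda>x. rpow (f x) a)"
proof (cases "a = 0")
  case False
  then have "continuous_on S (\<lambda>x. f x powr a)"
    using assms by (intro continuous_on_powr' continuous_on_const) auto
  with False show ?thesis by (simp add: rpow_def)
qed (simp add: rpow_def)

lemma jacobi_g_continuous:
  assumes "\<alpha> \<ge> 0" "\<beta> \<ge> 0"
  shows "continuous_on {-1..1} (jacobi_g n \<alpha> \<beta>)"
  unfolding jacobi_g_def using assms by (intro continuous_intros continuous_on_rpow) auto

lemma is_max_on_exists:
  assumes "continuous_on {-1..1} f" "a \<le> b" "-1 \<le> a" "b \<le> 1"
  obtains M where "is_max_on (\<lambda>x. \<bar>f x\<bar>) {a..b} M"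
proof -
  have "continuous_on {a..b} (\<lambda>x. \<bar>f x\<bar>)"
    using assms by (intro continuous_intros continuous_on_subset[OF assms(1)]) auto
  then obtain t where "t \<in> {a..b}" "\<forall>x\<in>{a..b}. \<bar>f x\<bar> \<le> \<bar>f t\<bar>"
    using continuous_attains_sup[of "{a..b}" "\<lambda>x. \<bar>f x\<bar>"] assms(2) by auto
  then show thesis by (intro that[of "\<bar>f t\<bar>"]) (auto simp: is_max_on_def)
qed

lemma jacobi_zeros_eq: "jacobi_zeros n \<alpha> \<beta> = (\<lambda>u. 1 - 2 * u) ` jacobi_roots n \<alpha> \<beta>"
proof (intro set_eqI iffI)
  fix x assume "x \<in> jacobi_zeros n \<alpha> \<beta>"
  then have "(1 - x) / 2 \<in> jacobi_roots n \<alpha> \<beta>"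
    by (auto simp: jacobi_zeros_def jacobi_roots_def poly_jacobi_poly)
  then show "x \<in> (\<lambda>u. 1 - 2 * u) ` jacobi_roots n \<alpha> \<beta>" by (rule rev_image_eqI) (simp add: field_simps)
qed (auto simp: jacobi_zeros_def jacobi_roots_def poly_jacobi_poly)

lemma Max_jacobi_zeros:
  assumes "\<alpha> > -1" "\<beta> > -1" "n \<ge> 1"
  shows "Max (jacobi_zeros n \<alpha> \<beta>) = 1 - 2 * Min (jacobi_roots n \<alpha> \<beta>)"
proof -
  have "finite (jacobi_roots n \<alpha> \<beta>)" "jacobi_roots n \<alpha> \<beta> \<noteq> {}"
    using assms finite_jacobi_roots jacobi_roots_nonempty by auto
  then show ?thesis unfolding jacobi_zeros_eq by (intro Max_eqI) auto
qed

lemma jacobi_zeros_reflect: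
  assumes "\<alpha> > -1" "\<beta> > -1"
  shows "jacobi_zeros n \<beta> \<alpha> = uminus ` jacobi_zeros n \<alpha> \<beta>"
proof -
  have "poly (jacobi_poly n \<beta> \<alpha>) x = (-1) ^ n * poly (jacobi_poly n \<alpha> \<beta>) (- x)" for x
  proof -
    have e: "(1 - x) / 2 = 1 - (1 - - x) / 2" by (simp add: field_simps)
    have "poly (jacobi_u n \<beta> \<alpha>) (1 - (1 - - x) / 2) = (-1) ^ n * poly (jacobi_u n \<alpha> \<beta>) ((1 - - x) / 2)"
      using assms by (intro jacobi_u_reflect)
    then show ?thesis unfolding poly_jacobi_poly by (simp only: e[symmetric])
  qed
  then have iff: "x \<in> jacobi_zeros n \<beta> \<alpha> \<longleftrightarrow> - x \<in> jacobi_zeros n \<alpha> \<beta>" for x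
    by (auto simp: jacobi_zeros_def)
  show ?thesis
  proof (intro set_eqI iffI)
    fix x assume "x \<in> jacobi_zeros n \<beta> \<alpha>"
    then have "- x \<in> jacobi_zeros n \<alpha> \<beta>" by (rule iffD1[OF iff])
    then show "x \<in> uminus ` jacobi_zeros n \<alpha> \<beta>" by (rule rev_image_eqI) simp
  next
    fix x assume "x \<in> uminus ` jacobi_zeros n \<alpha> \<beta>"
    then obtain t where "t \<in> jacobi_zeros n \<alpha> \<beta>" "x = - t" by blast
    then show "x \<in> jacobi_zeros n \<beta> \<alpha>" by (intro iffD2[OF iff]) simp
  qed
qed

lemma nodal_right_eq:
  assumes "\<alpha> > -1" "\<beta> > -1" "n \<ge> 1"
  shows "nodal_right n \<alpha> \<beta> = {1 - 2 * Min (jacobi_roots n \<alpha> \<beta>)..1}"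
  by (simp add: nodal_right_def Max_jacobi_zeros[OF assms])

text \<open>Expressing the left interval through the first root for swapped parameters lets every
  statement near -1 follow by reflection from one near 1.\<close>

lemma nodal_left_eq:
  assumes "\<alpha> > -1" "\<beta> > -1" "n \<ge> 1"
  shows "nodal_left n \<alpha> \<beta> = {-1..- (1 - 2 * Min (jacobi_roots n \<beta> \<alpha>))}"
proof -
  let ?Z = "jacobi_zeros n \<beta> \<alpha>"
  have "finite (jacobi_roots n \<beta> \<alpha>)" "jacobi_roots n \<beta> \<alpha> \<noteq> {}"
    using assms finite_jacobi_roots jacobi_roots_nonempty by auto
  then have "finite ?Z" "?Z \<noteq> {}" by (simp_all add: jacobi_zeros_eq)
  then have "Min (jacobi_zeros n \<alpha> \<beta>) = - Max ?Z"
    unfolding jacobi_zeros_reflect[OF assms(2,1), of n] by (intro Min_eqI) auto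
  then show ?thesis by (simp add: nodal_left_def Max_jacobi_zeros[OF assms(2,1,3)])
qed

lemma jacobi_g_nodal_right_less:
  assumes "\<alpha> > 0" "\<beta> > 0" "n \<ge> 1" "x \<in> nodal_right n \<alpha> \<beta>"
  shows "\<bar>jacobi_g n \<alpha> \<beta> x\<bar> < R_star \<alpha> powr (-1/2)"
proof (rule abs_less_powr_minus_half)
  show "R_star \<alpha> > 0" using assms R_star_pos by simp
  have "0 \<le> (1 - x) / 2" "(1 - x) / 2 \<le> Min (jacobi_roots n \<alpha> \<beta>)"
    using assms nodal_right_eq[of \<alpha> \<beta> n] by auto
  then show "(jacobi_g n \<alpha> \<beta> x)\<^sup>2 < 1 / R_star \<alpha>"
    unfolding jacobi_g_square[OF assms(1,2)] using assms by (intro jacobi_first_peak_bound)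
qed

lemma nodal_left_reflect:
  assumes "\<alpha> > 0" "\<beta> > 0" "n \<ge> 1"
  shows "x \<in> nodal_left n \<alpha> \<beta> \<longleftrightarrow> - x \<in> nodal_right n \<beta> \<alpha>"
  using nodal_left_eq[of \<alpha> \<beta> n] nodal_right_eq[of \<beta> \<alpha> n] assms by auto

lemma jacobi_g_nodal_left_less:
  assumes "\<alpha> > 0" "\<beta> > 0" "n \<ge> 1" "x \<in> nodal_left n \<alpha> \<beta>"
  shows "\<bar>jacobi_g n \<alpha> \<beta> x\<bar> < R_star \<beta> powr (-1/2)"
  using jacobi_g_nodal_right_less[OF assms(2,1,3), of "- x"] nodal_left_reflect[OF assms(1-3)]
    jacobi_g_reflect[OF assms(2,1)] assms(4) by simp

lemma jacobi_g_le_nodal: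
  assumes "\<alpha> > 0" "\<beta> > 0" "n \<ge> 1" "x \<in> {-1..1}"
  shows "\<exists>t\<in>nodal_right n \<alpha> \<beta> \<union> nodal_left n \<alpha> \<beta>. \<bar>jacobi_g n \<alpha> \<beta> x\<bar> \<le> \<bar>jacobi_g n \<alpha> \<beta> t\<bar>"
proof -
  have c: "jacobi_norm n \<alpha> \<beta> > 0" using assms jacobi_norm_pos by simp
  have le: "\<bar>jacobi_g n \<alpha> \<beta> x\<bar> \<le> \<bar>jacobi_g n a b (1 - 2 * v)\<bar>"
    if "(jacobi_y n \<alpha> \<beta> ((1 - x) / 2))\<^sup>2 \<le> (jacobi_y n a b v)\<^sup>2" "a > 0" "b > 0" "jacobi_norm n a b = jacobi_norm n \<alpha> \<beta>" for a b v
  proof -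
    have "(jacobi_g n \<alpha> \<beta> x)\<^sup>2 \<le> (jacobi_g n a b (1 - 2 * v))\<^sup>2"
      using that(1) c unfolding jacobi_g_square[OF assms(1,2)] jacobi_g_square[OF that(2,3)] that(4) by simp
    then show ?thesis by (simp add: abs_le_square_iff)
  qed
  have "(1 - x) / 2 \<in> {0..1}" using assms by auto
  from jacobi_y_global_max[OF assms(1-3) this] show ?thesis
  proof
    assume "\<exists>v\<in>{0..Min (jacobi_roots n \<alpha> \<beta>)}. (jacobi_y n \<alpha> \<beta> ((1 - x) / 2))\<^sup>2 \<le> (jacobi_y n \<alpha> \<beta> v)\<^sup>2"
    then obtain v where v: "v \<in> {0..Min (jacobi_roots n \<alpha> \<beta>)}"
      "(jacobi_y n \<alpha> \<beta> ((1 - x) / 2))\<^sup>2 \<le> (jacobi_y n \<alpha> \<beta> v)\<^sup>2" by blast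
    then have "1 - 2 * v \<in> nodal_right n \<alpha> \<beta>" using nodal_right_eq[of \<alpha> \<beta> n] assms by auto
    with le[OF v(2) assms(1,2)] show ?thesis by blast
  next
    assume "\<exists>v\<in>{0..Min (jacobi_roots n \<beta> \<alpha>)}. (jacobi_y n \<alpha> \<beta> ((1 - x) / 2))\<^sup>2 \<le> (jacobi_y n \<beta> \<alpha> v)\<^sup>2"
    then obtain v where v: "v \<in> {0..Min (jacobi_roots n \<beta> \<alpha>)}"
      "(jacobi_y n \<alpha> \<beta> ((1 - x) / 2))\<^sup>2 \<le> (jacobi_y n \<beta> \<alpha> v)\<^sup>2" by blast
    then have "- (1 - 2 * v) \<in> nodal_left n \<alpha> \<beta>" using nodal_left_eq[of \<alpha> \<beta> n] assms by auto
    moreover have "\<bar>jacobi_g n \<alpha> \<beta> x\<bar> \<le> \<bar>jacobi_g n \<alpha> \<beta> (- (1 - 2 * v))\<bar>"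
      using le[OF v(2) assms(2,1)] jacobi_norm_commute jacobi_g_reflect[OF assms(1,2)] by metis
    ultimately show ?thesis by blast
  qed
qed

lemma jacobi_g_less:
  assumes "\<alpha> > 0" "\<beta> > 0" "n \<ge> 1" "x \<in> {-1..1}"
  shows "\<bar>jacobi_g n \<alpha> \<beta> x\<bar> < max (R_star \<alpha> powr (-1/2)) (R_star \<beta> powr (-1/2))"
  using jacobi_g_le_nodal[OF assms] jacobi_g_nodal_right_less[OF assms(1-3)]
    jacobi_g_nodal_left_less[OF assms(1-3)]
  by (metis Un_iff less_max_iff_disj order_le_less_trans)

lemma jacobi_g_le_1:
  assumes "\<alpha> \<ge> 0" "\<beta> \<ge> 0" "n \<ge> 1" "x \<in> {-1..1}"
  shows "\<bar>jacobi_g n \<alpha> \<beta> x\<bar> \<le> 1"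
proof -
  have interior: "\<bar>jacobi_g n \<alpha> \<beta> x\<bar> \<le> 1" if x: "x \<in> {-1<..<1}" for x
  proof -
    have np: "(t::real) \<notin> \<int>\<^sub>\<le>\<^sub>0" if "t > 0" for t using that by (auto elim!: nonpos_Ints_cases)
    \<comment> \<open>Both bases are positive, so \<open>rpow\<close> agrees with
      \<open>powr\<close> even for exponent 0.\<close>
    have g: "jacobi_g n a b x = sqrt (Gamma (real n + 1) * Gamma (real n + a + b + 1)
        / (Gamma (real n + a + 1) * Gamma (real n + b + 1)))
        * ((1 - x) / 2) powr (a / 2) * ((1 + x) / 2) powr (b / 2)
        * (\<Sum>k\<le>n. jacobi_coef n a b k * ((1 - x) / 2) ^ k)" for a b
      using x by (simp add: jacobi_g_def rpow_def poly_jacobi_poly jacobi_u_def poly_sum poly_monom)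
    have Gam: "continuous_on {0..1} (\<lambda>e. Gamma (f e))"
      if "continuous_on {0..1} f" "\<And>e. e \<in> {0..1} \<Longrightarrow> f e > 0" for f :: "real \<Rightarrow> real"
    proof (rule continuous_on_compose2[OF _ that(1)])
      show "continuous_on {0<..} (Gamma :: real \<Rightarrow> real)" using np by (intro continuous_on_Gamma) auto
    qed (use that(2) in auto)
    have Gam0: "Gamma (real n + (a + e) + 1) \<noteq> 0" if "a \<ge> 0" "e \<in> {0..1}" for a e
    proof -
      have "real n + (a + e) + 1 > 0" using that by auto
      then show ?thesis using Gamma_real_pos less_irrefl by metis
    qed
    have "continuous_on {0..1} (\<lambda>e. jacobi_coef n (\<alpha> + e) (\<beta> + e) k)" for k
    proof -
      have "pochhammer (\<alpha> + e + 1) k \<noteq> 0" if "e \<in> {0..1}" for e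
        using pochhammer_pos[of "\<alpha> + e + 1" k] that assms(1) by simp
      then show ?thesis unfolding jacobi_coef_def by (intro continuous_intros ballI) simp_all
    qed
    then have "continuous_on {0..1} (\<lambda>e. jacobi_g n (\<alpha> + e) (\<beta> + e) x)"
      unfolding g using x assms Gam0[of \<alpha>] Gam0[of \<beta>]
      by (intro continuous_on_mult continuous_on_real_sqrt continuous_on_divide continuous_on_const
          continuous_on_powr continuous_on_sum continuous_on_add continuous_on_id Gam ballI) simp_all
    then have "continuous_on (closure {0<..<1}) (\<lambda>e. \<bar>jacobi_g n (\<alpha> + e) (\<beta> + e) x\<bar>)"
      by (simp add: continuous_on_rabs)
    then have "\<bar>jacobi_g n (\<alpha> + 0) (\<beta> + 0) x\<bar> \<le> 1"
    proof (rule continuous_le_on_closure)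
      fix e :: real assume "e \<in> {0<..<1}"
      then have "\<alpha> + e > 0" "\<beta> + e > 0" using assms by auto
      then show "\<bar>jacobi_g n (\<alpha> + e) (\<beta> + e) x\<bar> \<le> 1"
        using jacobi_g_less[of "\<alpha> + e" "\<beta> + e" n x] R_star_powr_less_1[of "\<alpha> + e"] R_star_powr_less_1[of "\<beta> + e"]
          x assms(3) by auto
    qed simp
    then show ?thesis by simp
  qed
  have "continuous_on (closure {-1<..<1}) (\<lambda>x. \<bar>jacobi_g n \<alpha> \<beta> x\<bar>)"
    using jacobi_g_continuous[OF assms(1,2), of n] by (simp add: continuous_on_rabs)
  then show ?thesis
    by (rule continuous_le_on_closure) (use assms(4) interior in auto)
qed

section \<open>Comparison with \<open>T_bound\<close>\<close>

lemma le_powr_fourth: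
  fixes x t :: real
  assumes "x ^ 4 \<le> t"
  shows "\<bar>x\<bar> \<le> t powr (1/4)"
proof -
  have "\<bar>x\<bar> = (\<bar>x\<bar> ^ 4) powr (1/4)"
  proof (cases "x = 0")
    case False
    then have "(\<bar>x\<bar> ^ 4) powr (1/4) = \<bar>x\<bar> powr (4 * (1/4))" by (simp only: powr_numeral[symmetric] powr_powr zero_less_abs_iff)
    then show ?thesis by simp
  qed simp
  also have "\<dots> \<le> t powr (1/4)" using assms by (intro powr_mono2) auto
  finally show ?thesis .
qed

lemma jacobi_g_le_T_bound:
  assumes "\<alpha> > 0" "\<beta> > 0" "n \<ge> 1" "x \<in> {-1..1}"
  shows "\<bar>jacobi_g n \<alpha> \<beta> x\<bar> \<le> T_bound n \<alpha> \<beta>"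
  unfolding T_bound_def
proof (rule le_powr_fourth)
  define m where "m = real n + 1"
  define g where "g = jacobi_g n \<alpha> \<beta> x"
  define q where "q = m * (m + (\<alpha> + \<beta>))"
  define T where "T = m * (m + (\<alpha> + \<beta>)) / ((m + \<alpha>) * (m + \<beta>))"
  have m: "m \<ge> 2" using assms by (simp add: m_def)
  \<comment> \<open>Hence T = q/(q + \<alpha> \<beta>), and the case q <= \<alpha> \<beta> means T
    <= 1/2.\<close>
  have den: "(m + \<alpha>) * (m + \<beta>) = q + \<alpha> * \<beta>" by (simp add: q_def algebra_simps)
  have q: "q > 0" using m assms by (simp add: q_def)
  have "g ^ 4 \<le> T"
  proof (cases "q \<le> \<alpha> * \<beta>")
    case True
    have "g ^ 4 = (jacobi_norm n \<alpha> \<beta> * (jacobi_y n \<alpha> \<beta> ((1 - x) / 2))\<^sup>2)\<^sup>2"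
      unfolding jacobi_g_square[OF assms(1,2), symmetric] g_def by simp
    also have "\<dots> \<le> (2 * real n + 1) * (\<alpha> + \<beta>) / (4 * \<alpha> * \<beta>)"
      using assms by (intro jacobi_agmon_bound) auto
    also have "\<dots> \<le> T"
    proof -
      have "(2 * real n + 1) * (\<alpha> + \<beta>) \<le> 2 * q"
      proof -
        have "(2 * real n + 1) * (\<alpha> + \<beta>) \<le> (2 * m) * (m + (\<alpha> + \<beta>))"
          using assms m by (intro mult_mono) (auto simp: m_def)
        then show ?thesis by (simp add: q_def)
      qed
      \<comment> \<open>The goal in cross-multiplied form; the case assumption gives q + \<alpha>
        \<beta> <= 2 \<alpha> \<beta>.\<close>
      then have "(2 * real n + 1) * (\<alpha> + \<beta>) * (q + \<alpha> * \<beta>) \<le> (2 * q) * (2 * (\<alpha> * \<beta>))"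
        by (rule mult_mono) (use True q assms in auto)
      then show ?thesis unfolding T_def den q_def[symmetric]
        using q assms by (simp add: divide_simps add_pos_pos mult_ac)
    qed
    finally show ?thesis .
  next
    case False
    have T_half: "1 / 2 \<le> T" unfolding T_def den q_def[symmetric] using False q assms
      by (simp add: pos_le_divide_eq add_pos_pos)
    \<comment> \<open>From m >= 2, that is n >= 1. The left side is 1/(1 + a/2), matching the second
      entry of the minimum in \<open>R_star_square_ge\<close>.\<close>
    have T_ge: "2 / (2 + a) \<le> m * (m + (a + b)) / ((m + a) * (m + b))" if "a > 0" "b > 0" for a b
    proof -
      have "2 / (2 + a) \<le> m / (m + a)" using m that by (simp add: field_simps)
      also have "\<dots> = m * (m + b) / ((m + a) * (m + b))" using m that by simp
      also have "\<dots> \<le> m * (m + (a + b)) / ((m + a) * (m + b))"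
        using m that by (intro divide_right_mono mult_left_mono) auto
      finally show ?thesis .
    qed
    \<comment> \<open>The chain is g^4 <= 1/R^2 <= 1/min(2, 1 + a/2) = max(1/2, 2/(2 + a)), and T
      dominates both entries.\<close>
    have key: "g ^ 4 \<le> T" if "\<bar>g\<bar> < R_star a powr (-1/2)" "a > 0" "2 / (2 + a) \<le> T" for a
    proof -
      have R: "R_star a > 0" using that R_star_pos by simp
      have "\<bar>g\<bar> ^ 4 \<le> (R_star a powr (-1/2)) ^ 4" using that by (intro power_mono) auto
      also have "\<dots> = 1 / (R_star a)\<^sup>2"
      proof -
        have "(R_star a powr (-1/2)) ^ 4 = R_star a powr (-2)" using R by (simp add: powr_power)
        also have "\<dots> = 1 / (R_star a)\<^sup>2" using R by (simp add: powr_minus_divide)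
        finally show ?thesis .
      qed
      also have "\<dots> \<le> 1 / min 2 (1 + a / 2)"
        using R_star_square_ge[of a] that R by (intro divide_left_mono mult_pos_pos) auto
      also have "\<dots> \<le> T"
        using that(2,3) T_half by (auto simp: min_def field_simps)
      finally show ?thesis by simp
    qed
    have "\<bar>g\<bar> < R_star \<alpha> powr (-1/2) \<or> \<bar>g\<bar> < R_star \<beta> powr (-1/2)"
      using jacobi_g_less[OF assms] by (simp add: g_def less_max_iff_disj)
    moreover have "2 / (2 + \<alpha>) \<le> T" "2 / (2 + \<beta>) \<le> T"
      using T_ge[of \<alpha> \<beta>] T_ge[of \<beta> \<alpha>] assms by (simp_all add: T_def add_ac mult_ac)
    ultimately show ?thesis using key assms by blast
  qed
  also have "T = (real n + 1) * (real n + \<alpha> + \<beta> + 1) / ((real n + \<alpha> + 1) * (real n + \<beta> + 1))"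
    by (simp add: T_def m_def add_ac)
  finally show "jacobi_g n \<alpha> \<beta> x ^ 4
    \<le> (real n + 1) * (real n + \<alpha> + \<beta> + 1) / ((real n + \<alpha> + 1) * (real n + \<beta> + 1))"
    by (simp add: g_def)
qed

text \<open>If a parameter vanishes, \<open>T_bound\<close> is 1 and the \<open>R_star\<close>
  maximum is at least 1, so |g| <= 1 suffices.\<close>

lemma jacobi_g_le_all:
  assumes "\<alpha> \<ge> 0" "\<beta> \<ge> 0" "n \<ge> 1" "x \<in> {-1..1}"
  shows "\<bar>jacobi_g n \<alpha> \<beta> x\<bar> \<le> min (T_bound n \<alpha> \<beta>) (max (R_star \<alpha> powr (-1/2)) (R_star \<beta> powr (-1/2)))"
proof (cases "\<alpha> = 0 \<or> \<beta> = 0")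
  case True
  then have "T_bound n \<alpha> \<beta> = 1" using assms by (auto simp: T_bound_def mult.commute)
  moreover have "max (R_star \<alpha> powr (-1/2)) (R_star \<beta> powr (-1/2)) \<ge> 1"
    using True by (auto simp: R_star_def le_max_iff_disj)
  ultimately show ?thesis using jacobi_g_le_1[OF assms] by simp
next
  case False
  with assms have "\<alpha> > 0" "\<beta> > 0" by auto
  then show ?thesis using jacobi_g_less[of \<alpha> \<beta> n x] jacobi_g_le_T_bound[of \<alpha> \<beta> n x] assms by simp
qed

section \<open>Maxima over the whole interval and over the outer nodal intervals\<close>

lemma jacobi_g_max_nodal:
  assumes "\<alpha> > 0" "\<beta> > 0" "n \<ge> 1"
  shows "\<exists>M \<mu>p \<mu>m. is_max_on (\<lambda>x. \<bar>jacobi_g n \<alpha> \<beta> x\<bar>) {-1..1} M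
           \<and> is_max_on (\<lambda>x. \<bar>jacobi_g n \<alpha> \<beta> x\<bar>) (nodal_right n \<alpha> \<beta>) \<mu>p
           \<and> is_max_on (\<lambda>x. \<bar>jacobi_g n \<alpha> \<beta> x\<bar>) (nodal_left n \<alpha> \<beta>) \<mu>m
           \<and> M = max \<mu>p \<mu>m
           \<and> max \<mu>p \<mu>m < max (R_star \<alpha> powr (-1/2)) (R_star \<beta> powr (-1/2))
           \<and> max (R_star \<alpha> powr (-1/2)) (R_star \<beta> powr (-1/2)) < 1"
proof -
  let ?g = "\<lambda>x. \<bar>jacobi_g n \<alpha> \<beta> x\<bar>"
  have cont: "continuous_on {-1..1} (jacobi_g n \<alpha> \<beta>)" using assms by (intro jacobi_g_continuous) auto
  have r: "0 < Min (jacobi_roots n \<alpha> \<beta>)" "Min (jacobi_roots n \<alpha> \<beta>) < 1"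
    and l: "0 < Min (jacobi_roots n \<beta> \<alpha>)" "Min (jacobi_roots n \<beta> \<alpha>) < 1"
    using assms by (intro Min_jacobi_roots; simp)+
  have right: "nodal_right n \<alpha> \<beta> = {1 - 2 * Min (jacobi_roots n \<alpha> \<beta>)..1}"
    and left: "nodal_left n \<alpha> \<beta> = {-1..- (1 - 2 * Min (jacobi_roots n \<beta> \<alpha>))}"
    using assms by (intro nodal_right_eq nodal_left_eq; simp)+
  obtain M where M: "is_max_on ?g {-1..1} M" by (rule is_max_on_exists[OF cont, of "-1" 1]) auto
  obtain \<mu>p where p: "is_max_on ?g (nodal_right n \<alpha> \<beta>) \<mu>p"
    unfolding right by (rule is_max_on_exists[OF cont, of "1 - 2 * Min (jacobi_roots n \<alpha> \<beta>)" 1]) (use r in auto)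
  obtain \<mu>m where m: "is_max_on ?g (nodal_left n \<alpha> \<beta>) \<mu>m"
    unfolding left by (rule is_max_on_exists[OF cont, of "-1" "- (1 - 2 * Min (jacobi_roots n \<beta> \<alpha>))"]) (use l in auto)
  have sub: "nodal_right n \<alpha> \<beta> \<subseteq> {-1..1}" "nodal_left n \<alpha> \<beta> \<subseteq> {-1..1}"
    using r l by (auto simp: right left)
  obtain x where x: "x \<in> {-1..1}" "M = ?g x" using M by (auto simp: is_max_on_def)
  obtain t where t: "t \<in> nodal_right n \<alpha> \<beta> \<union> nodal_left n \<alpha> \<beta>" "?g x \<le> ?g t"
    using jacobi_g_le_nodal[OF assms x(1)] by blast
  have "M = max \<mu>p \<mu>m"
  proof (rule antisym)
    show "M \<le> max \<mu>p \<mu>m" using t x p m by (auto simp: is_max_on_def le_max_iff_disj intro: order_trans)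
    show "max \<mu>p \<mu>m \<le> M" using M p m sub by (auto simp: is_max_on_def)
  qed
  \<comment> \<open>The strict pointwise bound passes to M because the maximum is attained.\<close>
  moreover have "M < max (R_star \<alpha> powr (-1/2)) (R_star \<beta> powr (-1/2))"
    using jacobi_g_less[OF assms x(1)] x(2) by simp
  moreover have "max (R_star \<alpha> powr (-1/2)) (R_star \<beta> powr (-1/2)) < 1"
    using R_star_powr_less_1 assms by simp
  ultimately show ?thesis using M p m by blast
qed

theorem theorem1p2:
  fixes n :: nat
  assumes "n \<ge> 1"
  shows
    "(\<forall>\<alpha> \<beta> :: real. \<alpha> > 0 \<and> \<beta> > 0 \<longrightarrow>
        (\<exists>M \<mu>p \<mu>m. is_max_on (\<lambda>x. \<bar>jacobi_g n \<alpha> \<beta> x\<bar>) {-1..1} M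
           \<and> is_max_on (\<lambda>x. \<bar>jacobi_g n \<alpha> \<beta> x\<bar>) (nodal_right n \<alpha> \<beta>) \<mu>p
           \<and> is_max_on (\<lambda>x. \<bar>jacobi_g n \<alpha> \<beta> x\<bar>) (nodal_left n \<alpha> \<beta>) \<mu>m
           \<and> M = max \<mu>p \<mu>m
           \<and> max \<mu>p \<mu>m < max (R_star \<alpha> powr (-1/2)) (R_star \<beta> powr (-1/2))
           \<and> max (R_star \<alpha> powr (-1/2)) (R_star \<beta> powr (-1/2)) < 1))
     \<and> (\<forall>\<alpha> \<beta> :: real. \<alpha> \<ge> 0 \<and> \<beta> \<ge> 0 \<longrightarrow>
        (\<exists>M. is_max_on (\<lambda>x. \<bar>jacobi_g n \<alpha> \<beta> x\<bar>) {-1..1} M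
           \<and> M \<le> max (R_star \<alpha> powr (-1/2)) (R_star \<beta> powr (-1/2))))
     \<and> (\<forall>\<alpha> \<beta> :: real. \<alpha> \<ge> 0 \<and> \<beta> \<ge> 0 \<longrightarrow>
        (\<exists>M. is_max_on (\<lambda>x. \<bar>jacobi_g n \<alpha> \<beta> x\<bar>) {-1..1} M
           \<and> M \<le> min (T_bound n \<alpha> \<beta>)
                     (max (R_star \<alpha> powr (-1/2)) (R_star \<beta> powr (-1/2)))))"
proof -
  \<comment> \<open>The bound of part (3) implies that of part (2), so both use the same M.\<close>
  have bound: "\<exists>M. is_max_on (\<lambda>x. \<bar>jacobi_g n \<alpha> \<beta> x\<bar>) {-1..1} M
    \<and> M \<le> min (T_bound n \<alpha> \<beta>) (max (R_star \<alpha> powr (-1/2)) (R_star \<beta> powr (-1/2)))"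
    if ab: "\<alpha> \<ge> 0" "\<beta> \<ge> 0" for \<alpha> \<beta> :: real
  proof -
    obtain M where M: "is_max_on (\<lambda>x. \<bar>jacobi_g n \<alpha> \<beta> x\<bar>) {-1..1} M"
      by (rule is_max_on_exists[OF jacobi_g_continuous[OF ab], of "-1" 1]) auto
    then obtain x where "x \<in> {-1..1}" "M = \<bar>jacobi_g n \<alpha> \<beta> x\<bar>" by (auto simp: is_max_on_def)
    then show ?thesis using M jacobi_g_le_all[OF ab assms] by blast
  qed
  show ?thesis
  proof (intro conjI allI impI; elim conjE)
    fix \<alpha> \<beta> :: real assume "\<alpha> \<ge> 0" "\<beta> \<ge> 0"
    from bound[OF this] show "\<exists>M. is_max_on (\<lambda>x. \<bar>jacobi_g n \<alpha> \<beta> x\<bar>) {-1..1} M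
           \<and> M \<le> max (R_star \<alpha> powr (-1/2)) (R_star \<beta> powr (-1/2))"
      by auto
  qed (use jacobi_g_max_nodal[OF _ _ assms] bound in blast)+
qed

end
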